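(* Let $d\ge2$ and let $T\subset\mathbb R^d$ be a (nondegenerate) simplex. Then the degrees of freedom $$(t_{F,i}^{\intercal}\tau n,q)_F,\quad q\in\mathbb P_0(F),\ i=1,\dots,d-1,\ F\in\mathcal F(T),$$ $$(\Pi_F(\tau n),q)_F,\quad q\in\mathbb K_Fx_F,\ F\in\mathcal F(T),$$ $$(\tau,q)_T,\quad q\in\mathbb P_0(T;\mathbb S\cap\mathbb T),$$ are unisolvent for the space $\Sigma_0^+(T;\mathbb S\cap\mathbb T)$. (The second family is trivial when $d=2$.)
   Context: $\mathbb M=\mathbb R^{d\times d}$; $\mathbb S,\mathbb K,\mathbb T$ are its subspaces of symmetric, skew-symmetric and traceless matrices; $\operatorname{dev}\tau=\tau-\frac1d(\operatorname{tr}\tau)I$; $a\otimes b=ab^{\intercal}$. $\mathbb P_m(D;\mathbb X)$ is the space of $\mathbb X$-valued polynomials on $D$ of total degree at most $m$. $(\cdot,\cdot)_D$ is the $L^2(D)$ inner product. $T$ has vertices $\mathtt v_0,\dots,\mathtt v_d$ and barycentric coordinates $\lambda_0,\dots,\lambda_d$; $F_\ell$ is the facet opposite to $\mathtt v_\ell$; $\mathcal F(T)$ is the set of facets; $n$ is the outward unit normal on $\partial T$; $t_{j,\ell}:=\mathtt v_\ell-\mathtt v_j$. For a facet $F$ with unit normal $n_F$: $\Pi_F w:=(I-n_Fn_F^{\intercal})w|_F$; $\{t_{F,i}\}_{i=1}^{d-1}$ is a fixed orthonormal basis of the tangent space of $F$; $x_F^c:=|F|^{-1}\int_F x\,ds$;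 $x_F:=\Pi_F(x-x_F^c)$, the same expression also denoting its affine extension to $T$; $\mathbb K_F:=\{A\in\mathbb K:An_F=0\}$; $\mathbb K_Fx_F:=\{Ax_F:A\in\mathbb K_F\}$. For each $\ell=0,\dots,d$ fix $j_\ell\in\{0,\dots,d\}\setminus\{\ell\}$ and put $I_\ell:=\{0,\dots,d\}\setminus\{\ell,j_\ell\}$. For $A\in\mathbb K_{F_\ell}$ set $$E_{\ell,A}:=\sum_{i\in I_\ell}(t_{i,j_\ell}^{\intercal}A\,x_{F_\ell})\,\operatorname{dev}(\nabla\lambda_i\otimes t_{i,\ell}),$$ $$\mathbb P_0^+(T;\mathbb T):=\mathbb P_0(T;\mathbb T)+\operatorname{span}\{E_{\ell,A}:A\in\mathbb K_{F_\ell},\ \ell=0,\dots,d\}.$$ Let $\mathbb B_1^{tn}(T;\mathbb T):=\{\tau\in\mathbb P_1(T;\mathbb T):\Pi_F(\tau n)=0\ \forall F\in\mathcal F(T)\}$ and $$\Sigma_0^+(T;\mathbb S\cap\mathbb T):=\{\tau\in\mathbb P_0^+(T;\mathbb T)\oplus\mathbb B_1^{tn}(T;\mathbb T):(\tau,q)_T=0\ \ \forall q\in\mathbb P_0(T;\mathbb K)\}.$$ Unisolvent means: the number of degrees of freedom (with $q$ running through bases of the indicated test spaces) equals the dimension of the space, and an element of the space for which all degrees of freedom vanish is zero. *)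

theory Defs
  imports "HOL-Analysis.Analysis" "HOL-Library.Function_Algebras"
begin

section \<open>Functions as a real vector space\<close>

instantiation "fun" :: (type, scaleR) scaleR
begin

definition scaleR_fun_def: "c *\<^sub>R f = (\<lambda>x. c *\<^sub>R f x)"

instance ..

end

lemma scaleR_fun_apply [simp]: "(c *\<^sub>R f) x = c *\<^sub>R f x"
  by (simp add: scaleR_fun_def)

instance "fun" :: (type, real_vector) real_vector
  by standard (auto simp: fun_eq_iff scaleR_add_right scaleR_add_left)

text \<open>A function whose domain is \<open>D\<close> is represented by its extension by zero, so that
  equality and dimension are those of functions on \<open>D\<close>.\<close>

definition fun_on :: "'a set \<Rightarrow> ('a \<Rightarrow> 'b::zero) \<Rightarrow> 'a \<Rightarrow> 'b" where
  "fun_on D f = (\<lambda>x. if x \<in> D then f x else 0)"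

definition basis_of :: "'a::real_vector set \<Rightarrow> 'a set \<Rightarrow> bool" where
  "basis_of B V \<longleftrightarrow> independent B \<and> span B = V"

text \<open>Unisolvence for \<open>V\<close> of the degrees of freedom \<open>\<phi> k\<close>, \<open>k \<in> I\<close>.\<close>

definition unisolvent :: "'a::real_vector set \<Rightarrow> 'k set \<Rightarrow> ('k \<Rightarrow> 'a \<Rightarrow> real) \<Rightarrow> bool" where
  "unisolvent V I \<phi> \<longleftrightarrow>
     finite I \<and> card I = dim V \<and> (\<forall>\<tau>\<in>V. (\<forall>k\<in>I. \<phi> k \<tau> = 0) \<longrightarrow> \<tau> = 0)"


section \<open>Matrices and polynomials\<close>

definition sym_mats :: "(real^'n^'n) set" where
  "sym_mats = {A. transpose A = A}"

definition skew_mats :: "(real^'n^'n) set" where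
  "skew_mats = {A. transpose A = - A}"

definition traceless_mats :: "(real^'n^'n) set" where
  "traceless_mats = {A. trace A = 0}"

definition dev :: "real^'n^'n \<Rightarrow> real^'n^'n" where
  "dev A = A - (trace A / real CARD('n)) *\<^sub>R mat 1"

definition outer :: "real^'n \<Rightarrow> real^'n \<Rightarrow> real^'n^'n" (infixl "\<otimes>\<^sub>o" 70) where
  "a \<otimes>\<^sub>o b = (\<chi> r s. a $ r * b $ s)"

text \<open>Polynomials on \<open>D\<close> of total degree at most \<open>m\<close> with values in the subspace \<open>X\<close>;
  \<open>\<alpha>\<close> runs through the multi-indices.\<close>

definition polys :: "nat \<Rightarrow> (real^'n) set \<Rightarrow> 'b::real_vector set \<Rightarrow> (real^'n \<Rightarrow> 'b) set" where
  "polys m D X = {f. \<exists>c. (\<forall>\<alpha>. c \<alpha> \<in> X) \<and>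
     f = fun_on D (\<lambda>x. \<Sum>\<alpha> | sum \<alpha> UNIV \<le> m. (\<Prod>i\<in>UNIV. (x $ i) ^ \<alpha> i) *\<^sub>R c \<alpha>)}"


section \<open>Integration\<close>

text \<open>Surface measure of a flat set \<open>F\<close>: Lebesgue measure in orthonormal coordinates of the affine
  hull of \<open>F\<close>.  It does not depend on the choice of the origin \<open>a\<close> and of the orthonormal basis
  \<open>B\<close> of the direction space, since Lebesgue measure is invariant under isometries.\<close>

definition orthonormal_chart :: "'a::euclidean_space set \<Rightarrow> 'a \<times> 'a set \<Rightarrow> bool" where
  "orthonormal_chart F = (\<lambda>(a, B). a \<in> F \<and> pairwise orthogonal B \<and> (\<forall>b\<in>B. norm b = 1) \<and>
     affine hull F = (\<lambda>w. a + w) ` span B)"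

definition surface_measure :: "'a::euclidean_space set \<Rightarrow> 'a measure" where
  "surface_measure F = (case (SOME p. orthonormal_chart F p) of (a, B) \<Rightarrow>
     distr (\<Pi>\<^sub>M b\<in>B. lborel) borel (\<lambda>y. a + (\<Sum>b\<in>B. y b *\<^sub>R b)))"

definition centroid :: "'a::euclidean_space set \<Rightarrow> 'a" where
  "centroid F = inverse (measure (surface_measure F) F) *\<^sub>R (LINT x:F|surface_measure F. x)"

text \<open>On matrices the library's inner product \<open>\<bullet>\<close> is the Frobenius product.\<close>

definition L2_inner :: "'a measure \<Rightarrow> 'a set \<Rightarrow> ('a \<Rightarrow> 'b::real_inner) \<Rightarrow> ('a \<Rightarrow> 'b) \<Rightarrow> real" where
  "L2_inner M D f g = (LINT x:D|M. f x \<bullet> g x)"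


section \<open>Geometry of the simplex\<close>

text \<open>The vertices are \<open>v 0, \<dots>, v d\<close> with \<open>d = CARD('n)\<close>.\<close>

definition nondegenerate :: "(nat \<Rightarrow> real^'n) \<Rightarrow> bool" where
  "nondegenerate v \<longleftrightarrow> inj_on v {..CARD('n)} \<and> \<not> affine_dependent (v ` {..CARD('n)})"

definition simplex_of :: "(nat \<Rightarrow> real^'n) \<Rightarrow> (real^'n) set" where
  "simplex_of v = convex hull (v ` {..CARD('n)})"

definition facet :: "(nat \<Rightarrow> real^'n) \<Rightarrow> nat \<Rightarrow> (real^'n) set" where
  "facet v l = convex hull (v ` ({..CARD('n)} - {l}))"

definition tangent_space :: "(nat \<Rightarrow> real^'n) \<Rightarrow> nat \<Rightarrow> (real^'n) set" where
  "tangent_space v l = span {x - y | x y. x \<in> facet v l \<and> y \<in> facet v l}"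

definition unit_normal :: "(nat \<Rightarrow> real^'n) \<Rightarrow> nat \<Rightarrow> real^'n \<Rightarrow> bool" where
  "unit_normal v l n \<longleftrightarrow> norm n = 1 \<and> (\<forall>w\<in>tangent_space v l. n \<bullet> w = 0)"

definition outward_normal :: "(nat \<Rightarrow> real^'n) \<Rightarrow> nat \<Rightarrow> real^'n" where
  "outward_normal v l =
     (THE n. unit_normal v l n \<and> (\<forall>x\<in>facet v l. n \<bullet> (x - v l) > 0))"

definition orthonormal_frame :: "(nat \<Rightarrow> real^'n) \<Rightarrow> nat \<Rightarrow> (nat \<Rightarrow> real^'n) \<Rightarrow> bool" where
  "orthonormal_frame v l t \<longleftrightarrow>
     (\<forall>i\<in>{1..CARD('n) - 1}. \<forall>k\<in>{1..CARD('n) - 1}. t i \<bullet> t k = (if i = k then 1 else 0)) \<and>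
     span (t ` {1..CARD('n) - 1}) = tangent_space v l"

definition barycentric :: "(nat \<Rightarrow> real^'n) \<Rightarrow> nat \<Rightarrow> real^'n \<Rightarrow> real" where
  "barycentric v i = (THE f. (\<exists>a c. f = (\<lambda>x. a \<bullet> x + c)) \<and>
     (\<forall>k\<le>CARD('n). f (v k) = (if k = i then 1 else 0)))"

definition grad_barycentric :: "(nat \<Rightarrow> real^'n) \<Rightarrow> nat \<Rightarrow> real^'n" where
  "grad_barycentric v i = (THE g. \<forall>x. GDERIV (barycentric v i) x :> g)"

definition edge :: "(nat \<Rightarrow> real^'n) \<Rightarrow> nat \<Rightarrow> nat \<Rightarrow> real^'n" where
  "edge v j l = v l - v j"

text \<open>For the unit normal \<open>n\<close> of a facet \<open>F\<close>: the projection \<open>\<Pi>\<^sub>F\<close>, the field \<open>x\<^sub>F\<close> (affine on the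
  whole space) and the space \<open>\<bbbK>\<^sub>F\<close>.\<close>

definition tang_proj :: "real^'n \<Rightarrow> real^'n \<Rightarrow> real^'n" where
  "tang_proj n w = (mat 1 - n \<otimes>\<^sub>o n) *v w"

definition facet_pos :: "(real^'n) set \<Rightarrow> real^'n \<Rightarrow> real^'n \<Rightarrow> real^'n" where
  "facet_pos F n x = tang_proj n (x - centroid F)"

definition facet_skew :: "real^'n \<Rightarrow> (real^'n^'n) set" where
  "facet_skew n = {A \<in> skew_mats. A *v n = 0}"

definition facet_rot :: "(real^'n) set \<Rightarrow> real^'n \<Rightarrow> (real^'n \<Rightarrow> real^'n) set" where
  "facet_rot F n = {fun_on F (\<lambda>x. A *v facet_pos F n x) | A. A \<in> facet_skew n}"


section \<open>Shape function spaces\<close>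

text \<open>\<open>nF l\<close> is the chosen unit normal of the facet opposite to \<open>v l\<close>, and \<open>j l\<close> is the
  index chosen for that facet.\<close>

definition E_fun ::
  "(nat \<Rightarrow> real^'n) \<Rightarrow> (nat \<Rightarrow> real^'n) \<Rightarrow> (nat \<Rightarrow> nat) \<Rightarrow> nat \<Rightarrow> real^'n^'n \<Rightarrow> real^'n \<Rightarrow> real^'n^'n" where
  "E_fun v nF j l A = fun_on (simplex_of v) (\<lambda>x. \<Sum>i\<in>{..CARD('n)} - {l, j l}.
     (edge v i (j l) \<bullet> (A *v facet_pos (facet v l) (nF l) x)) *\<^sub>R
       dev (grad_barycentric v i \<otimes>\<^sub>o edge v i l))"

definition P0_plus ::
  "(nat \<Rightarrow> real^'n) \<Rightarrow> (nat \<Rightarrow> real^'n) \<Rightarrow> (nat \<Rightarrow> nat) \<Rightarrow> (real^'n \<Rightarrow> real^'n^'n) set" where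
  "P0_plus v nF j = {p + e | p e. p \<in> polys 0 (simplex_of v) traceless_mats \<and>
     e \<in> span {E_fun v nF j l A | l A. l \<le> CARD('n) \<and> A \<in> facet_skew (nF l)}}"

definition B1_tn ::
  "(nat \<Rightarrow> real^'n) \<Rightarrow> (nat \<Rightarrow> real^'n) \<Rightarrow> (real^'n \<Rightarrow> real^'n^'n) set" where
  "B1_tn v nF = {\<tau> \<in> polys 1 (simplex_of v) traceless_mats.
     \<forall>l\<le>CARD('n). \<forall>x\<in>facet v l. tang_proj (nF l) (\<tau> x *v outward_normal v l) = 0}"

definition Sigma0_plus ::
  "(nat \<Rightarrow> real^'n) \<Rightarrow> (nat \<Rightarrow> real^'n) \<Rightarrow> (nat \<Rightarrow> nat) \<Rightarrow> (real^'n \<Rightarrow> real^'n^'n) set" where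
  "Sigma0_plus v nF j = {\<tau>. (\<exists>p\<in>P0_plus v nF j. \<exists>b\<in>B1_tn v nF. \<tau> = p + b) \<and>
     (\<forall>q\<in>polys 0 (simplex_of v) skew_mats. L2_inner lborel (simplex_of v) \<tau> q = 0)}"


section \<open>Degrees of freedom\<close>

text \<open>The labels carry the facet index \<open>l\<close>, the index \<open>i\<close> of the tangent vector, and the
  test function \<open>q\<close>.\<close>

datatype 'n dof =
    Facet_Const nat nat "real^'n \<Rightarrow> real"
  | Facet_Rot nat "real^'n \<Rightarrow> real^'n"
  | Interior "real^'n \<Rightarrow> real^'n^'n"

fun dof_value ::
  "(nat \<Rightarrow> real^'n) \<Rightarrow> (nat \<Rightarrow> real^'n) \<Rightarrow> (nat \<Rightarrow> nat \<Rightarrow> real^'n) \<Rightarrow>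
    'n::finite dof \<Rightarrow> (real^'n \<Rightarrow> real^'n^'n) \<Rightarrow> real" where
  "dof_value v nF tF (Facet_Const l i q) \<tau> =
     L2_inner (surface_measure (facet v l)) (facet v l) (\<lambda>x. tF l i \<bullet> (\<tau> x *v outward_normal v l)) q"
| "dof_value v nF tF (Facet_Rot l q) \<tau> =
     L2_inner (surface_measure (facet v l)) (facet v l)
       (\<lambda>x. tang_proj (nF l) (\<tau> x *v outward_normal v l)) q"
| "dof_value v nF tF (Interior q) \<tau> = L2_inner lborel (simplex_of v) \<tau> q"

definition dofs ::
  "(nat \<Rightarrow> (real^'n \<Rightarrow> real) set) \<Rightarrow> (nat \<Rightarrow> (real^'n \<Rightarrow> real^'n) set) \<Rightarrow>
    (real^'n \<Rightarrow> real^'n^'n) set \<Rightarrow> 'n::finite dof set" where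
  "dofs QC QR QI =
     {Facet_Const l i q | l i q. l \<le> CARD('n) \<and> i \<in> {1..CARD('n) - 1} \<and> q \<in> QC l} \<union>
     {Facet_Rot l q | l q. l \<le> CARD('n) \<and> q \<in> QR l} \<union>
     {Interior q | q. q \<in> QI}"

end

theory Submission
  imports Defs
begin

text \<open>
  The shape space is cut out of \<open>V = P0_plus + B1_tn\<close> by the moments against constant skew matrices.
  Together with these moments the degrees of freedom form a coordinate system of \<open>V\<close>; setting some
  of the coordinates to zero then leaves the others unisolvent (\<open>unisolvent_kernel\<close>).  The numbers
  agree because \<open>V\<close> has a spanning family indexed by the same labels as the functionals.  To a constant
  moment on a facet belongs one of the \<open>CARD('n) - 1\<close> bubbles at the opposite vertex, to a rotational moment the enrichment with the
  corresponding skew matrix, to an interior moment its own constant test matrix.  So it suffices that a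
  combination with vanishing moments has zero coefficients.

  This holds because the system is triangular.  Write \<open>g l\<close> for the gradient of the barycentric coordinate
  of vertex \<open>v l\<close>, a normal of the opposite facet, and consider a field composed of a constant \<open>p\<close>,
  enrichments with matrices \<open>A l\<close> and bubbles.  Bubbles have no tangential-normal trace.  The enrichment
  of facet \<open>l\<close> has none on the other facets, and on its own one the trace is a multiple of the rotation
  \<open>x \<mapsto> A l x\<^sub>F\<close> (\<open>E_own_facet\<close>, \<open>normal_trace\<close>).

  Rotations about the centroid have mean zero, so vanishing constant moments make all \<open>g l\<close>
  eigenvectors of \<open>p\<close>; as the \<open>g l\<close> satisfy exactly one linear relation and \<open>p\<close> is
  traceless, \<open>p = 0\<close> (\<open>g_eigenvectors_traceless\<close>).  The rotational moments then contain
  \<open>\<integral> \<bar>A l x\<^sub>F\<bar>\<^sup>2\<close>, so \<open>A l = 0\<close>.  What remains is a combination of bubbles with zero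
  integral.  Its vertex values are diagonal in the gradients, and the uniqueness of the linear relation
  between the gradients separates the contributions of the vertices
  (\<open>vertex_diagonal_independent\<close>); the weights are the integrals of the barycentric coordinates, which
  are positive.
\<close>

section \<open>Square systems of functionals\<close>

lemma sum_fun_apply: "(\<Sum>a\<in>A. f a) x = (\<Sum>a\<in>A. f a x)"
  for f :: "'a \<Rightarrow> 'b \<Rightarrow> 'c::comm_monoid_add"
  by (induction A rule: infinite_finite_induct) auto

text \<open>Injectivity gives surjectivity for a square system.  The rows \<open>k \<mapsto> M i k\<close> are regarded as
  elements of the function space, where independence and span need no matrix type of size \<open>card K\<close>.\<close>

lemma square_system_solvable:
  fixes M :: "'m \<Rightarrow> 'k \<Rightarrow> real"
  assumes finK: "finite K" and finJ: "finite J" and card: "card J = card K"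
    and trivial_kernel: "\<And>c. (\<forall>k\<in>K. (\<Sum>i\<in>J. c i * M i k) = 0) \<Longrightarrow> \<forall>i\<in>J. c i = 0"
  shows "\<exists>c. \<forall>k\<in>K. (\<Sum>i\<in>J. c i * M i k) = b k"
proof -
  define u where "u = (\<lambda>i k. if k \<in> K then M i k else 0)"
  define e :: "'k \<Rightarrow> 'k \<Rightarrow> real" where "e = (\<lambda>k l. if l = k then 1 else 0)"
  have in_span_e: "f \<in> span (e ` K)" if "\<And>l. l \<notin> K \<Longrightarrow> f l = 0" for f
  proof -
    have "f = (\<Sum>k\<in>K. f k *\<^sub>R e k)"
      using that by (auto simp: fun_eq_iff sum_fun_apply e_def finK if_distrib[of "\<lambda>t. _ * t"] cong: if_cong)
    also have "\<dots> \<in> span (e ` K)"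
      by (intro span_sum span_scale span_base) auto
    finally show ?thesis .
  qed
  have inj: "inj_on u J"
  proof (rule inj_onI, rule ccontr)
    fix i i' assume i: "i \<in> J" "i' \<in> J" "u i = u i'" "i \<noteq> i'"
    define c where "c = (\<lambda>a. if a = i then 1 else if a = i' then - 1 else (0::real))"
    have "(\<Sum>a\<in>J. c a * M a k) = 0" if "k \<in> K" for k
    proof -
      have "(\<Sum>a\<in>J. c a * M a k) = (\<Sum>a\<in>{i, i'}. c a * M a k)"
        using i finJ by (intro sum.mono_neutral_right) (auto simp: c_def)
      also have "\<dots> = u i k - u i' k"
        using i(4) that by (simp add: c_def u_def)
      finally show ?thesis using i(3) by simp
    qed
    then have "c i = 0" using trivial_kernel i by blast
    then show False by (simp add: c_def)
  qed
  have indep: "independent (u ` J)"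
  proof (rule independent_if_scalars_zero)
    fix f x assume 0: "(\<Sum>x\<in>u ` J. f x *\<^sub>R x) = 0" and x: "x \<in> u ` J"
    have "(\<Sum>i\<in>J. f (u i) * M i k) = 0" if "k \<in> K" for k
    proof -
      have "(\<Sum>i\<in>J. f (u i) *\<^sub>R u i) k = 0"
        using 0 by (simp add: sum.reindex[OF inj] o_def)
      then show ?thesis using that by (simp add: sum_fun_apply u_def)
    qed
    then show "f x = 0" using trivial_kernel[of "\<lambda>i. f (u i)"] x by auto
  qed (use finJ in simp)
  have u_e: "u ` J \<subseteq> span (e ` K)"
    using in_span_e by (auto simp: u_def)
  have card_e: "card (e ` K) \<le> card K"
    using finK by (rule card_image_le)
  \<comment> \<open>A right-hand side outside the span would enlarge the \<open>card K\<close> independent rows.\<close>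
  define b' where "b' = (\<lambda>k. if k \<in> K then b k else 0)"
  have "b' \<in> span (u ` J)"
  proof (rule ccontr)
    assume b': "b' \<notin> span (u ` J)"
    then have ins: "independent (insert b' (u ` J))"
      using indep by (simp add: independent_insert)
    have "insert b' (u ` J) \<subseteq> span (e ` K)"
      using u_e in_span_e[of b'] by (auto simp: b'_def)
    then have "card (insert b' (u ` J)) \<le> card (e ` K)"
      using independent_span_bound[OF finite_imageI[OF finK] ins] by simp
    moreover have "b' \<notin> u ` J" using b' by (metis span_base)
    ultimately show False
      using card_e finJ card card_image[OF inj] by simp
  qed
  then obtain c where c: "b' = (\<Sum>x\<in>u ` J. c x *\<^sub>R x)"
    using finJ by (auto simp: span_finite)
  have "(\<Sum>i\<in>J. c (u i) * M i k) = b k" if "k \<in> K" for k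
  proof -
    have "b' k = (\<Sum>i\<in>J. c (u i) *\<^sub>R u i) k"
      by (simp add: c sum.reindex[OF inj] o_def)
    then show ?thesis using that by (simp add: sum_fun_apply u_def b'_def)
  qed
  then show ?thesis by (intro exI[of _ "\<lambda>i. c (u i)"] ballI)
qed

text \<open>The form in which unisolvence is proved.  If a family \<open>s\<close> and a set \<open>K\<close> of functionals have the same
  size and only the zero combination of \<open>s\<close> is annihilated by \<open>K\<close>, then the functionals are a
  coordinate system of the span.  Imposing that those outside \<open>I\<close> vanish leaves a coordinate
  subspace, on which the functionals in \<open>I\<close> are unisolvent: its dimension and the independence
  of the constraints come for free.\<close>

lemma unisolvent_kernel:
  fixes s :: "'m \<Rightarrow> 'a::real_vector" and \<phi> :: "'k \<Rightarrow> 'a \<Rightarrow> real"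
  assumes fin: "finite K" "finite J" "card J = card K" and IK: "I \<subseteq> K"
    and add: "\<And>k x y. k \<in> K \<Longrightarrow> x \<in> span (s ` J) \<Longrightarrow> y \<in> span (s ` J) \<Longrightarrow> \<phi> k (x + y) = \<phi> k x + \<phi> k y"
    and scale: "\<And>k c x. k \<in> K \<Longrightarrow> x \<in> span (s ` J) \<Longrightarrow> \<phi> k (c *\<^sub>R x) = c * \<phi> k x"
    and trivial_kernel: "\<And>c. (\<forall>k\<in>K. \<phi> k (\<Sum>i\<in>J. c i *\<^sub>R s i) = 0) \<Longrightarrow> \<forall>i\<in>J. c i = 0"
  shows "unisolvent {\<tau> \<in> span (s ` J). \<forall>k\<in>K - I. \<phi> k \<tau> = 0} I \<phi>"
proof -
  let ?V = "span (s ` J)"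
  have sum: "\<phi> k (\<Sum>a\<in>A. c a *\<^sub>R x a) = (\<Sum>a\<in>A. c a * \<phi> k (x a))"
    if "k \<in> K" "finite A" "\<And>a. a \<in> A \<Longrightarrow> x a \<in> ?V" for k A c and x :: "'b \<Rightarrow> 'a"
    using that(2,3)
  proof (induction A rule: finite_induct)
    case empty
    show ?case using scale[OF that(1), of 0 0] by (simp add: span_zero)
  next
    case (insert a A)
    then have "(\<Sum>a\<in>A. c a *\<^sub>R x a) \<in> ?V" by (intro span_sum span_scale) auto
    with insert show ?case by (simp add: add[OF that(1)] scale[OF that(1)] span_scale)
  qed
  have expand: "\<exists>c. \<tau> = (\<Sum>i\<in>J. c i *\<^sub>R s i)" if "\<tau> \<in> ?V" for \<tau>
    using that
  proof (induction rule: span_induct_alt)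
    case base
    show ?case by (rule exI[of _ "\<lambda>_. 0"]) simp
  next
    case (step a x y)
    then obtain i c where i: "i \<in> J" "x = s i" and c: "y = (\<Sum>i\<in>J. c i *\<^sub>R s i)" by blast
    have "a *\<^sub>R x + y = (\<Sum>k\<in>J. ((if k = i then a else 0) + c k) *\<^sub>R s k)"
      using i fin by (simp add: c scaleR_add_left sum.distrib if_distrib[of "\<lambda>t. t *\<^sub>R _"] cong: if_cong)
    then show ?case by (rule exI[of _ "\<lambda>k. (if k = i then a else 0) + c k"])
  qed
  have unique: "\<tau> = 0" if "\<tau> \<in> ?V" "\<And>k. k \<in> K \<Longrightarrow> \<phi> k \<tau> = 0" for \<tau>
  proof -
    obtain c where "\<tau> = (\<Sum>i\<in>J. c i *\<^sub>R s i)" using expand \<open>\<tau> \<in> ?V\<close> by blast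
    with trivial_kernel[of c] that(2) show ?thesis by simp
  qed
  \<comment> \<open>The functionals have a dual basis in the whole space; its part in \<open>I\<close> spans the kernel.\<close>
  have "\<exists>\<psi>\<in>?V. \<forall>l\<in>K. \<phi> l \<psi> = (if l = k then 1 else 0)" for k
  proof -
    have sums: "\<phi> l (\<Sum>i\<in>J. c i *\<^sub>R s i) = (\<Sum>i\<in>J. c i * \<phi> l (s i))" if "l \<in> K" for c l
      using that fin by (intro sum) (auto intro: span_base)
    obtain c where "\<forall>l\<in>K. (\<Sum>i\<in>J. c i * \<phi> l (s i)) = (if l = k then 1 else 0)"
      using square_system_solvable[OF fin, of "\<lambda>i l. \<phi> l (s i)" "\<lambda>l. if l = k then 1 else 0"]
        trivial_kernel sums by auto
    then have "\<forall>l\<in>K. \<phi> l (\<Sum>i\<in>J. c i *\<^sub>R s i) = (if l = k then 1 else 0)"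
      by (simp add: sums)
    moreover have "(\<Sum>i\<in>J. c i *\<^sub>R s i) \<in> ?V"
      by (intro span_sum span_scale span_base) auto
    ultimately show ?thesis by blast
  qed
  then obtain \<psi> where \<psi>V: "\<And>k. \<psi> k \<in> ?V"
    and dual: "\<And>k l. l \<in> K \<Longrightarrow> \<phi> l (\<psi> k) = (if l = k then 1 else 0)" by metis
  let ?W = "{\<tau> \<in> ?V. \<forall>k\<in>K - I. \<phi> k \<tau> = 0}"
  have finI: "finite I" using IK fin finite_subset by blast
  have inj: "inj_on \<psi> I"
  proof (rule inj_onI)
    fix k l assume "k \<in> I" "l \<in> I" "\<psi> k = \<psi> l"
    then show "k = l" using dual[of k k] dual[of k l] IK by (auto split: if_splits)
  qed
  have coeff: "\<phi> l (\<Sum>k\<in>I. c k *\<^sub>R \<psi> k) = (if l \<in> I then c l else 0)" if "l \<in> K" for c l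
    using finI that IK by (subst sum) (auto simp: \<psi>V dual if_distrib[of "\<lambda>t. _ * t"] subset_iff cong: if_cong)
  have "dim ?W = card (\<psi> ` I)"
  proof (rule dim_unique)
    show "\<psi> ` I \<subseteq> ?W" using \<psi>V dual by auto
    show "?W \<subseteq> span (\<psi> ` I)"
    proof
      fix \<tau> assume \<tau>: "\<tau> \<in> ?W"
      define \<sigma> where "\<sigma> = (\<Sum>k\<in>I. \<phi> k \<tau> *\<^sub>R \<psi> k)"
      have \<sigma>: "\<sigma> \<in> ?V" unfolding \<sigma>_def by (intro span_sum span_scale \<psi>V)
      have "\<phi> l (\<tau> + (- 1) *\<^sub>R \<sigma>) = 0" if "l \<in> K" for l
      proof -
        have "\<phi> l (\<tau> + (- 1) *\<^sub>R \<sigma>) = \<phi> l \<tau> - \<phi> l \<sigma>"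
          using \<tau> \<sigma> that add[of l \<tau> "(- 1) *\<^sub>R \<sigma>"] scale[of l \<sigma> "- 1"] by (simp add: span_neg)
        also have "\<phi> l \<sigma> = \<phi> l \<tau>"
          using coeff[OF that, of "\<lambda>k. \<phi> k \<tau>"] \<tau> that by (auto simp: \<sigma>_def)
        finally show ?thesis by simp
      qed
      moreover have "\<tau> + (- 1) *\<^sub>R \<sigma> \<in> ?V"
        using \<tau> \<sigma> by (intro span_add span_scale) auto
      ultimately have "\<tau> + (- 1) *\<^sub>R \<sigma> = 0" using unique by blast
      then have "\<tau> = \<sigma>" by simp
      moreover have "\<sigma> \<in> span (\<psi> ` I)"
        unfolding \<sigma>_def by (intro span_sum span_scale span_base) auto
      ultimately show "\<tau> \<in> span (\<psi> ` I)" by simp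
    qed
    show "independent (\<psi> ` I)"
    proof (rule independent_if_scalars_zero)
      fix f x assume 0: "(\<Sum>x\<in>\<psi> ` I. f x *\<^sub>R x) = 0" and x: "x \<in> \<psi> ` I"
      then obtain l where l: "l \<in> I" "x = \<psi> l" by blast
      have "(\<Sum>k\<in>I. f (\<psi> k) *\<^sub>R \<psi> k) = 0"
        using 0 by (simp add: sum.reindex[OF inj] o_def)
      moreover have "\<phi> l 0 = 0"
        using scale[of l 0 0] l IK by (auto simp: span_zero)
      ultimately show "f x = 0"
        using coeff[of l "\<lambda>k. f (\<psi> k)"] l IK by auto
    qed (use finI in simp)
  qed simp
  then have "card I = dim ?W" by (simp add: card_image[OF inj])
  then show ?thesis
    unfolding unisolvent_def using finI unique by blast
qed

section \<open>Integration over compact convex sets\<close>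

text \<open>The common interface to Lebesgue measure on the simplex and surface measure on a facet: continuous
  functions are integrable, and a nonnegative one with zero integral vanishes everywhere on \<open>D\<close>.\<close>

definition full_support :: "'a::euclidean_space measure \<Rightarrow> 'a set \<Rightarrow> bool" where
  "full_support M D \<longleftrightarrow> sets M = sets borel \<and> compact D \<and> emeasure M D < \<infinity> \<and>
     (\<forall>x\<in>D. \<forall>r>0. emeasure M (ball x r \<inter> D) > 0)"

text \<open>Every ball around a point of a convex set contains a smaller ball around a relative interior point,
  and within the affine hull the smaller ball stays inside the set.  So positivity on the affine hull
  suffices.\<close>

lemma full_supportI:
  fixes D :: "'a::euclidean_space set"
  assumes "sets M = sets borel" "compact D" "convex D" "emeasure M D < \<infinity>"
    and pos: "\<And>y s. y \<in> affine hull D \<Longrightarrow> s > 0 \<Longrightarrow> emeasure M (ball y s \<inter> affine hull D) > 0"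
  shows "full_support M D"
  unfolding full_support_def
proof (intro conjI ballI allI impI)
  fix x and r :: real assume x: "x \<in> D" and r: "r > 0"
  have "x \<in> closure (rel_interior D)"
    using x closure_subset convex_closure_rel_interior[OF \<open>convex D\<close>] by blast
  then obtain y where y: "y \<in> rel_interior D" "dist y x < r"
    using closure_approachable r by blast
  then obtain t where t: "t > 0" "ball y t \<inter> affine hull D \<subseteq> D"
    and yD: "y \<in> D" by (auto simp: mem_rel_interior_ball)
  define s where "s = min t (r - dist y x)"
  have "ball y s \<subseteq> ball x r"
  proof
    fix z assume "z \<in> ball y s"
    then have "dist y z < r - dist y x" by (simp add: s_def)
    then show "z \<in> ball x r" using dist_triangle[of x z y] by (simp add: dist_commute)
  qed
  then have "ball y s \<inter> affine hull D \<subseteq> ball x r \<inter> D"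
    using t by (auto simp: s_def)
  moreover have "ball x r \<inter> D \<in> sets M"
    using assms by (simp add: compact_imp_closed)
  ultimately have "emeasure M (ball y s \<inter> affine hull D) \<le> emeasure M (ball x r \<inter> D)"
    by (rule emeasure_mono)
  moreover have "emeasure M (ball y s \<inter> affine hull D) > 0"
    using y yD t by (intro pos) (auto simp: s_def hull_inc)
  ultimately show "emeasure M (ball x r \<inter> D) > 0" by (rule order_less_le_trans[rotated])
qed (use assms in auto)

lemma full_support_integrable:
  fixes f :: "'a::euclidean_space \<Rightarrow> 'b::euclidean_space"
  assumes "full_support M D" "continuous_on D f"
  shows "set_integrable M D f"
proof -
  have D: "D \<in> sets borel" "compact D" "sets M = sets borel" "emeasure M D < \<infinity>"
    using assms by (auto simp: full_support_def intro: borel_compact)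
  obtain C where C: "\<And>x. x \<in> D \<Longrightarrow> norm (f x) \<le> C"
    using compact_imp_bounded[OF compact_continuous_image[OF assms(2) D(2)]]
    by (auto simp: bounded_iff)
  have "(\<lambda>x. indicator D x *\<^sub>R f x) \<in> borel_measurable M"
    using borel_measurable_continuous_on_indicator[OF D(1) assms(2)]
    by (simp add: measurable_cong_sets[OF D(3) refl])
  then have "integrable M (\<lambda>x. indicator D x *\<^sub>R (indicator D x *\<^sub>R f x))"
    using D C by (intro integrableI_bounded_set_indicator[where B = C]) auto
  moreover have "(\<lambda>x. indicator D x *\<^sub>R (indicator D x *\<^sub>R f x)) = (\<lambda>x. indicator D x *\<^sub>R f x)"
    by (auto simp: fun_eq_iff indicator_def)
  ultimately show ?thesis by (simp add: set_integrable_def)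
qed

lemma integral_eq_0_imp_zero:
  fixes f :: "'a::euclidean_space \<Rightarrow> real"
  assumes M: "full_support M D" and f: "continuous_on D f" and nonneg: "\<And>x. x \<in> D \<Longrightarrow> f x \<ge> 0"
    and 0: "(LINT x:D|M. f x) = 0" and x: "x \<in> D"
  shows "f x = 0"
proof (rule ccontr)
  assume "f x \<noteq> 0"
  then obtain r where r: "r > 0" "\<And>y. y \<in> D \<Longrightarrow> dist x y < r \<Longrightarrow> f y \<noteq> 0"
    using continuous_on_avoid[OF f x] by blast
  have D: "D \<in> sets borel" "sets M = sets borel"
    using M by (auto simp: full_support_def intro: borel_compact)
  have "AE y in M. indicator D y *\<^sub>R f y = 0"
    using 0 nonneg full_support_integrable[OF M f]
    unfolding set_lebesgue_integral_def set_integrable_def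
    by (subst (asm) integral_nonneg_eq_0_iff_AE) (auto simp: indicator_def)
  then have "AE y in M. y \<notin> ball x r \<inter> D"
    by eventually_elim (use r in \<open>auto simp: indicator_def split: if_splits\<close>)
  then have "emeasure M (ball x r \<inter> D) = 0"
    using D by (subst (asm) AE_iff_measurable[OF _ refl]) (auto simp: sets_eq_imp_space_eq[OF D(2)] Int_def)
  moreover have "emeasure M (ball x r \<inter> D) > 0"
    using M x r(1) by (simp add: full_support_def)
  ultimately show False by simp
qed

lemma full_support_lborel:
  fixes D :: "'a::euclidean_space set"
  assumes "compact D" "convex D" "affine hull D = UNIV"
  shows "full_support lborel D"
proof (rule full_supportI)
  show "emeasure lborel D < \<infinity>"
    using assms(1) by (rule emeasure_compact_finite)
  show "emeasure lborel (ball y s \<inter> affine hull D) > 0" if "s > 0" for y :: 'a and s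
  proof -
    have "emeasure lborel (ball y s) \<noteq> 0"
      using content_ball_pos[OF that, of y] by (auto simp: measure_def)
    then show ?thesis using assms by (simp add: zero_less_iff_neq_zero)
  qed
qed (use assms in auto)

section \<open>Surface measure\<close>

lemma surface_measure_chart:
  fixes F :: "'a::euclidean_space set"
  assumes "F \<noteq> {}"
  obtains a B where "a \<in> F" "pairwise orthogonal B" "\<And>b. b \<in> B \<Longrightarrow> norm b = 1"
    "affine hull F = (\<lambda>w. a + w) ` span B" "finite B"
    "surface_measure F = distr (\<Pi>\<^sub>M b\<in>B. lborel) borel (\<lambda>y. a + (\<Sum>b\<in>B. y b *\<^sub>R b))"
proof -
  obtain a where a: "a \<in> F" using assms by blast
  then have aff: "a \<in> affine hull F" by (simp add: hull_inc)
  define S where "S = (\<lambda>x. - a + x) ` (affine hull F)"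
  have "subspace S"
    unfolding S_def using affine_diffs_subspace[OF affine_affine_hull aff]
    by (simp add: image_def)
  then obtain B where B: "pairwise orthogonal B" "\<And>b. b \<in> B \<Longrightarrow> norm b = 1" "span B = S"
    using orthonormal_basis_subspace by metis
  have "(\<lambda>w. a + w) ` span B = affine hull F"
    unfolding B(3) S_def by (simp add: image_image)
  then have "orthonormal_chart F (a, B)"
    using a B by (simp add: orthonormal_chart_def)
  then have ex: "orthonormal_chart F (SOME p. orthonormal_chart F p)" by (rule someI)
  obtain a' B' where p: "(SOME p. orthonormal_chart F p) = (a', B')" by fastforce
  have B': "a' \<in> F" "pairwise orthogonal B'" "\<And>b. b \<in> B' \<Longrightarrow> norm b = 1"
    "affine hull F = (\<lambda>w. a' + w) ` span B'"
    using ex unfolding p by (auto simp: orthonormal_chart_def)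
  have "independent B'"
    using B'(2,3) by (intro pairwise_orthogonal_independent) force+
  then have "finite B'" by (rule independent_imp_finite)
  with B' show thesis
    using that[of a' B'] by (simp add: surface_measure_def p)
qed

text \<open>In the orthonormal chart the coordinates of a point are bounded by its distance from the origin of the
  chart, and conversely a small box of coordinates is mapped into a small ball.  Hence \<open>F\<close> is
  contained in the image of a box of finite measure, and balls contain the images of boxes of positive
  measure.\<close>

lemma full_support_surface_measure:
  fixes F :: "'a::euclidean_space set"
  assumes "compact F" "convex F" "F \<noteq> {}"
  shows "full_support (surface_measure F) F"
proof -
  obtain a B where aF: "a \<in> F" and orth: "pairwise orthogonal B"
    and unit: "\<And>b. b \<in> B \<Longrightarrow> norm b = 1"
    and hull: "affine hull F = (\<lambda>w. a + w) ` span B" and fin: "finite B"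
    and sm: "surface_measure F = distr (\<Pi>\<^sub>M b\<in>B. lborel) borel (\<lambda>y. a + (\<Sum>b\<in>B. y b *\<^sub>R b))"
    using surface_measure_chart[OF \<open>F \<noteq> {}\<close>] by blast
  interpret product_sigma_finite "\<lambda>_::'a. lborel :: real measure" ..
  let ?P = "\<Pi>\<^sub>M b\<in>B. (lborel :: real measure)"
  define \<Phi> where "\<Phi> = (\<lambda>y. a + (\<Sum>b\<in>B. y b *\<^sub>R b))"
  have meas [measurable]: "\<Phi> \<in> measurable ?P borel" unfolding \<Phi>_def by measurable
  have em: "emeasure (surface_measure F) X = emeasure ?P (\<Phi> -` X \<inter> space ?P)" if "X \<in> sets borel" for X
    unfolding sm \<Phi>_def[symmetric] using that by (simp add: emeasure_distr)
  have coord: "(\<Phi> y - a) \<bullet> b = y b" if "b \<in> B" for y b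
  proof -
    have "(\<Phi> y - a) \<bullet> b = (\<Sum>c\<in>B. y c * (c \<bullet> b))" by (simp add: \<Phi>_def inner_sum_left)
    also have "\<dots> = (\<Sum>c\<in>{b}. y c * (c \<bullet> b))"
      using orth that fin by (intro sum.mono_neutral_right) (auto simp: pairwise_def orthogonal_def)
    also have "\<dots> = y b" using unit[OF that] by (simp add: dot_square_norm)
    finally show ?thesis .
  qed
  have in_hull: "\<Phi> y \<in> affine hull F" for y
    unfolding hull \<Phi>_def by (intro imageI span_sum span_scale span_base)
  show ?thesis
  proof (rule full_supportI)
    obtain R where R: "\<And>x. x \<in> F \<Longrightarrow> norm x \<le> R"
      using compact_imp_bounded[OF \<open>compact F\<close>] by (auto simp: bounded_iff)
    have "\<Phi> -` F \<inter> space ?P \<subseteq> (\<Pi>\<^sub>E b\<in>B. {- (2 * R)..2 * R})"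
    proof (intro subsetI PiE_I)
      fix y b assume y: "y \<in> \<Phi> -` F \<inter> space ?P" and b: "b \<in> B"
      have "\<bar>y b\<bar> \<le> norm (\<Phi> y - a) * norm b"
        using Cauchy_Schwarz_ineq2[of "\<Phi> y - a" b] coord[OF b, of y] by simp
      also have "\<dots> \<le> norm (\<Phi> y) + norm a" using unit[OF b] by (simp add: norm_triangle_ineq4)
      also have "\<dots> \<le> 2 * R" using R[of "\<Phi> y"] R[OF aF] y by simp
      finally show "y b \<in> {- (2 * R)..2 * R}" by auto
    qed (auto simp: space_PiM PiE_def extensional_def)
    then have "emeasure ?P (\<Phi> -` F \<inter> space ?P) \<le> emeasure ?P (\<Pi>\<^sub>E b\<in>B. {- (2 * R)..2 * R})"
      using fin by (intro emeasure_mono) (auto intro!: sets_PiM_I_finite)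
    also have "\<dots> = (\<Prod>b\<in>B. ennreal (4 * R))"
      using R[OF aF] norm_ge_zero[of a] fin by (subst emeasure_PiM) (auto intro!: prod.cong simp del: norm_ge_zero)
    also have "\<dots> < \<infinity>" by (simp add: ennreal_power flip: infinity_ennreal_def) (simp add: power_less_top_ennreal)
    finally show "emeasure (surface_measure F) F < \<infinity>"
      using \<open>compact F\<close> by (simp add: em borel_compact)
  next
    fix y and s :: real assume y: "y \<in> affine hull F" and s: "s > 0"
    then obtain w where "w \<in> span B" "y = a + w" using hull by auto
    then obtain z where z: "y = \<Phi> z" using fin by (auto simp: span_finite \<Phi>_def)
    \<comment> \<open>The sum of \<open>card B\<close> coordinate errors below \<open>\<delta>\<close> is below \<open>s\<close>; the \<open>+ 1\<close> covers \<open>B = {}\<close>.\<close>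
    define \<delta> where "\<delta> = s / (card B + 1)"
    have \<delta>: "\<delta> > 0" using s by (simp add: \<delta>_def)
    have "(\<Pi>\<^sub>E b\<in>B. {z b - \<delta><..<z b + \<delta>}) \<subseteq> \<Phi> -` (ball y s \<inter> affine hull F) \<inter> space ?P"
    proof
      fix u assume u: "u \<in> (\<Pi>\<^sub>E b\<in>B. {z b - \<delta><..<z b + \<delta>})"
      have close: "\<bar>z b - u b\<bar> \<le> \<delta>" if "b \<in> B" for b
      proof -
        have "u b \<in> {z b - \<delta><..<z b + \<delta>}" using u that by (rule PiE_mem)
        then show ?thesis by auto
      qed
      have "\<Phi> z - \<Phi> u = (\<Sum>b\<in>B. (z b - u b) *\<^sub>R b)"
        by (simp add: \<Phi>_def scaleR_diff_left sum_subtractf)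
      then have "dist y (\<Phi> u) = norm (\<Sum>b\<in>B. (z b - u b) *\<^sub>R b)"
        by (simp add: z dist_norm)
      also have "\<dots> \<le> (\<Sum>b\<in>B. \<delta>)"
        using close unit by (intro sum_norm_le) auto
      also have "\<dots> < s" using s by (simp add: \<delta>_def field_simps)
      finally show "u \<in> \<Phi> -` (ball y s \<inter> affine hull F) \<inter> space ?P"
        using in_hull u by (auto simp: space_PiM PiE_def)
    qed
    moreover have sets: "ball y s \<inter> affine hull F \<in> sets borel" by simp
    ultimately have "emeasure ?P (\<Pi>\<^sub>E b\<in>B. {z b - \<delta><..<z b + \<delta>})
        \<le> emeasure (surface_measure F) (ball y s \<inter> affine hull F)"
      unfolding em[OF sets] by (intro emeasure_mono measurable_sets[OF meas]) auto
    moreover have "emeasure ?P (\<Pi>\<^sub>E b\<in>B. {z b - \<delta><..<z b + \<delta>}) = (\<Prod>b\<in>B. ennreal (2 * \<delta>))"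
      using \<delta> fin by (subst emeasure_PiM) auto
    moreover have "(\<Prod>b\<in>B. ennreal (2 * \<delta>)) > 0"
      using \<delta> fin by (subst zero_less_iff_neq_zero) (auto simp: prod_zero_iff ennreal_eq_0_iff simp del: prod_constant)
    ultimately show "emeasure (surface_measure F) (ball y s \<inter> affine hull F) > 0" by simp
  qed (use assms sm in auto)
qed

section \<open>Moments\<close>

lemma L2_inner_integrable:
  fixes f g :: "'a::euclidean_space \<Rightarrow> 'b::euclidean_space"
  assumes "full_support M D" "continuous_on D f" "continuous_on D g"
  shows "set_integrable M D (\<lambda>x. f x \<bullet> g x)"
  using assms by (intro full_support_integrable continuous_intros)

lemma L2_inner_commute: "L2_inner M D f g = L2_inner M D g f"
  by (simp add: L2_inner_def inner_commute)

lemma L2_inner_cong: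
  assumes "\<And>x. x \<in> D \<Longrightarrow> f x = f' x" "\<And>x. x \<in> D \<Longrightarrow> g x = g' x"
  shows "L2_inner M D f g = L2_inner M D f' g'"
  unfolding L2_inner_def set_lebesgue_integral_def
  using assms by (intro Bochner_Integration.integral_cong) (auto simp: indicator_def)

lemma L2_inner_add_left:
  fixes f g h :: "'a::euclidean_space \<Rightarrow> 'b::euclidean_space"
  assumes "full_support M D" "continuous_on D f" "continuous_on D g" "continuous_on D h"
  shows "L2_inner M D (\<lambda>x. f x + g x) h = L2_inner M D f h + L2_inner M D g h"
  unfolding L2_inner_def using assms by (simp add: inner_add_left set_integral_add L2_inner_integrable)

lemma L2_inner_scaleR_left: "L2_inner M D (\<lambda>x. c *\<^sub>R f x) h = c * L2_inner M D f h"
  unfolding L2_inner_def by simp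

lemma L2_inner_sum_left:
  fixes f :: "'i \<Rightarrow> 'a::euclidean_space \<Rightarrow> 'b::euclidean_space"
  assumes "full_support M D" "\<And>i. i \<in> I \<Longrightarrow> continuous_on D (f i)" "continuous_on D h"
  shows "L2_inner M D (\<lambda>x. \<Sum>i\<in>I. f i x) h = (\<Sum>i\<in>I. L2_inner M D (f i) h)"
  using assms(2)
proof (induction I rule: infinite_finite_induct)
  case (insert i I)
  then show ?case
    using assms(1,3) by (simp add: L2_inner_add_left continuous_on_sum)
qed (simp_all add: L2_inner_def set_lebesgue_integral_def)

lemma L2_inner_zero_on_span:
  fixes f :: "'a::euclidean_space \<Rightarrow> 'b::euclidean_space"
  assumes M: "full_support M D" and f: "continuous_on D f"
    and Q: "\<And>q. q \<in> Q \<Longrightarrow> continuous_on D q \<and> L2_inner M D f q = 0"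
    and q: "q \<in> span Q"
  shows "L2_inner M D f q = 0"
proof -
  have "continuous_on D q \<and> L2_inner M D f q = 0"
    using q
  proof (induction rule: span_induct_alt)
    case base
    show ?case by (simp add: L2_inner_def zero_fun_def set_lebesgue_integral_def)
  next
    case (step c x y)
    have "L2_inner M D f (c *\<^sub>R x + y) = L2_inner M D (\<lambda>t. c *\<^sub>R x t + y t) f"
      by (subst L2_inner_commute) (simp add: plus_fun_def)
    also have "\<dots> = c * L2_inner M D x f + L2_inner M D y f"
      using M f step Q by (subst L2_inner_add_left) (auto intro!: continuous_intros simp: L2_inner_scaleR_left)
    finally show ?case
      using step Q by (auto simp: L2_inner_commute[of M D f] plus_fun_def intro!: continuous_intros)
  qed
  then show ?thesis ..
qed

lemma L2_inner_self_eq_0: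
  fixes f :: "'a::euclidean_space \<Rightarrow> 'b::euclidean_space"
  assumes "full_support M D" "continuous_on D f" "L2_inner M D f f = 0" "x \<in> D"
  shows "f x = 0"
  using integral_eq_0_imp_zero[of M D "\<lambda>x. f x \<bullet> f x" x] assms
  by (auto simp: L2_inner_def intro!: continuous_intros)

lemma full_support_measure_pos:
  assumes "full_support M D" "D \<noteq> {}"
  shows "measure M D > 0"
proof -
  obtain x where x: "x \<in> D" using assms by blast
  have "0 < emeasure M (ball x 1 \<inter> D)" using assms x by (auto simp: full_support_def)
  also have "\<dots> \<le> emeasure M D"
    using assms by (intro emeasure_mono) (auto simp: full_support_def intro: borel_compact)
  finally show ?thesis
    using assms by (simp add: full_support_def measure_def enn2real_positive_iff)
qed

text \<open>This is why the constant facet moments do not see the rotational part of the trace.\<close>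

lemma centroid_moment:
  fixes D :: "'a::euclidean_space set"
  assumes M: "full_support (surface_measure D) D" and "D \<noteq> {}"
  shows "L2_inner (surface_measure D) D (\<lambda>x. x - centroid D) (\<lambda>_. w) = 0"
proof -
  let ?M = "surface_measure D"
  have pos: "measure ?M D > 0" using full_support_measure_pos[OF assms] .
  have int: "set_integrable ?M D (\<lambda>x. x)" using M by (intro full_support_integrable) auto
  have ind: "integrable ?M (indicator D :: 'a \<Rightarrow> real)"
    using full_support_integrable[OF M, of "\<lambda>_. 1::real"] by (simp add: set_integrable_def)
  have "L2_inner ?M D (\<lambda>x. x - centroid D) (\<lambda>_. w) = (LINT x:D|?M. x \<bullet> w) - (LINT x:D|?M. centroid D \<bullet> w)"
    unfolding L2_inner_def inner_diff_left
    using M by (intro set_integral_diff full_support_integrable) (auto intro!: continuous_intros)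
  also have "(LINT x:D|?M. x \<bullet> w) = (LINT x:D|?M. x) \<bullet> w"
    unfolding set_lebesgue_integral_def using int
    by (simp add: set_integrable_def flip: integral_inner_left)
  also have "(LINT x:D|?M. x) = measure ?M D *\<^sub>R centroid D"
    using pos by (simp add: centroid_def)
  also have "(LINT x:D|?M. centroid D \<bullet> w) = measure ?M D * (centroid D \<bullet> w)"
    using M by (simp add: set_lebesgue_integral_def full_support_def borel_compact)
  finally show ?thesis by simp
qed

section \<open>Polynomials of degree zero and one\<close>

lemma fun_on_apply [simp]: "x \<in> D \<Longrightarrow> fun_on D f x = f x"
  by (simp add: fun_on_def)

lemma fun_on_eq_iff: "fun_on D f = fun_on D g \<longleftrightarrow> (\<forall>x\<in>D. f x = g x)"
  by (auto simp: fun_on_def fun_eq_iff)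

lemma fun_on_add: "fun_on D f + fun_on D g = fun_on D (\<lambda>x. f x + g x)" for f :: "_ \<Rightarrow> 'b::monoid_add"
  by (auto simp: fun_on_def fun_eq_iff)

lemma fun_on_scaleR: "c *\<^sub>R fun_on D f = fun_on D (\<lambda>x. c *\<^sub>R f x)" for f :: "_ \<Rightarrow> 'b::real_vector"
  by (auto simp: fun_on_def fun_eq_iff)

lemma fun_on_zero: "fun_on D (\<lambda>_. 0) = 0"
  by (auto simp: fun_on_def fun_eq_iff)

lemma fun_on_sum: "(\<Sum>i\<in>I. fun_on D (f i)) = fun_on D (\<lambda>x. \<Sum>i\<in>I. f i x)" for f :: "_ \<Rightarrow> _ \<Rightarrow> 'b::comm_monoid_add"
  by (auto simp: fun_on_def fun_eq_iff sum_fun_apply)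

lemma fun_on_eq_0_iff: "fun_on D f = 0 \<longleftrightarrow> (\<forall>x\<in>D. f x = 0)"
  by (auto simp: fun_on_def fun_eq_iff)

lemma continuous_on_fun_on [simp]: "continuous_on D (fun_on D f) \<longleftrightarrow> continuous_on D f"
  by (rule continuous_on_cong) auto

lemma polys_0: "polys 0 D X = {fun_on D (\<lambda>_. c) | c. c \<in> X}" for D :: "(real^'n) set"
proof -
  have *: "{\<alpha>::'n \<Rightarrow> nat. sum \<alpha> UNIV \<le> 0} = {\<lambda>_. 0}"
    by (auto simp: fun_eq_iff)
  show ?thesis
    unfolding polys_def * by auto
qed

text \<open>The multi-indices of total degree at most one are zero and the unit vectors.\<close>

lemma polys_1:
  "polys 1 D X = {fun_on D (\<lambda>x. c0 + (\<Sum>i\<in>UNIV. (x $ i) *\<^sub>R c i)) | c0 c. c0 \<in> X \<and> (\<forall>i. c i \<in> X)}"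
  for D :: "(real^'n) set"
proof -
  define \<delta> :: "'n \<Rightarrow> 'n \<Rightarrow> nat" where "\<delta> = (\<lambda>i k. if k = i then 1 else 0)"
  define z :: "'n \<Rightarrow> nat" where "z = (\<lambda>_. 0)"
  have inj: "inj \<delta>" by (rule injI) (metis \<delta>_def zero_neq_one)
  have "z \<noteq> \<delta> i" for i by (metis \<delta>_def z_def zero_neq_one)
  then have z: "z \<notin> range \<delta>" by blast
  have "\<alpha> \<in> insert z (range \<delta>)" if "sum \<alpha> UNIV \<le> 1" for \<alpha>
  proof (cases "\<alpha> = z")
    case False
    then obtain i where i: "\<alpha> i > 0" by (auto simp: z_def fun_eq_iff)
    have "sum \<alpha> UNIV = \<alpha> i + sum \<alpha> (UNIV - {i})" by (simp add: sum.remove)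
    with that i have "\<alpha> i = 1" "sum \<alpha> (UNIV - {i}) = 0" by linarith+
    then have "\<alpha> = \<delta> i" by (auto simp: \<delta>_def fun_eq_iff)
    then show ?thesis by blast
  qed simp
  moreover have "sum (\<delta> i) UNIV \<le> 1" "sum z UNIV \<le> 1" for i by (simp_all add: \<delta>_def z_def)
  ultimately have set: "{\<alpha>. sum \<alpha> UNIV \<le> 1} = insert z (range \<delta>)" by blast
  have mono: "(\<Prod>k\<in>UNIV. (x $ k) ^ \<delta> i k) = x $ i" for x :: "real^'n" and i
  proof -
    have "(\<Prod>k\<in>UNIV. (x $ k) ^ \<delta> i k) = (\<Prod>k\<in>UNIV. if k = i then x $ k else 1)"
      by (intro prod.cong) (auto simp: \<delta>_def)
    then show ?thesis by simp
  qed
  have sum: "(\<Sum>\<alpha> | sum \<alpha> UNIV \<le> 1. (\<Prod>i\<in>UNIV. (x $ i) ^ \<alpha> i) *\<^sub>R c \<alpha>)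
      = c z + (\<Sum>i\<in>UNIV. (x $ i) *\<^sub>R c (\<delta> i))" for x :: "real^'n" and c :: "_ \<Rightarrow> 'a"
    unfolding set using z by (simp add: sum.reindex[OF inj] mono) (simp add: z_def)
  show ?thesis
  proof (intro equalityI subsetI)
    fix f assume "f \<in> polys 1 D X"
    then obtain c where "\<forall>\<alpha>. c \<alpha> \<in> X" "f = fun_on D (\<lambda>x. c z + (\<Sum>i\<in>UNIV. (x $ i) *\<^sub>R c (\<delta> i)))"
      unfolding polys_def sum by blast
    then show "f \<in> {fun_on D (\<lambda>x. c0 + (\<Sum>i\<in>UNIV. (x $ i) *\<^sub>R c i)) | c0 c. c0 \<in> X \<and> (\<forall>i. c i \<in> X)}"
      by (intro CollectI exI[of _ "c z"] exI[of _ "\<lambda>i. c (\<delta> i)"]) simp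
  next
    fix f assume "f \<in> {fun_on D (\<lambda>x. c0 + (\<Sum>i\<in>UNIV. (x $ i) *\<^sub>R c i)) | c0 c. c0 \<in> X \<and> (\<forall>i. c i \<in> X)}"
    then obtain c0 c where c: "c0 \<in> X" "\<forall>i. c i \<in> X"
      and f: "f = fun_on D (\<lambda>x. c0 + (\<Sum>i\<in>UNIV. (x $ i) *\<^sub>R c i))" by blast
    define C where "C = (\<lambda>\<alpha>. if \<alpha> = z then c0 else c (inv \<delta> \<alpha>))"
    have "C (\<delta> i) = c i" for i using z inj by (auto simp: C_def image_iff)
    then have "f = fun_on D (\<lambda>x. C z + (\<Sum>i\<in>UNIV. (x $ i) *\<^sub>R C (\<delta> i)))"
      by (simp add: f C_def)
    moreover have "\<forall>\<alpha>. C \<alpha> \<in> X" using c by (simp add: C_def)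
    ultimately show "f \<in> polys 1 D X" unfolding polys_def sum by blast
  qed
qed

lemma subspace_polys:
  assumes X: "subspace X"
  shows "subspace (polys m D X)"
proof (rule subspaceI)
  let ?P = "\<lambda>c x. \<Sum>\<alpha> | sum \<alpha> UNIV \<le> m. (\<Prod>i\<in>UNIV. (x $ i) ^ \<alpha> i) *\<^sub>R c \<alpha>"
  show "0 \<in> polys m D X"
    unfolding polys_def using subspace_0[OF X] by (auto intro!: exI[of _ "\<lambda>_. 0"] simp: fun_on_zero)
  show "f + g \<in> polys m D X" if fg: "f \<in> polys m D X" "g \<in> polys m D X" for f g
  proof -
    obtain c e where c: "\<forall>\<alpha>. c \<alpha> \<in> X" "f = fun_on D (?P c)" and e: "\<forall>\<alpha>. e \<alpha> \<in> X" "g = fun_on D (?P e)"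
      using fg unfolding polys_def by blast
    have "f + g = fun_on D (?P (\<lambda>\<alpha>. c \<alpha> + e \<alpha>))"
      by (simp add: c e fun_on_add scaleR_add_right sum.distrib)
    moreover have "\<forall>\<alpha>. c \<alpha> + e \<alpha> \<in> X" using c(1) e(1) subspace_add[OF X] by blast
    ultimately show ?thesis
      unfolding polys_def by (intro CollectI exI[of _ "\<lambda>\<alpha>. c \<alpha> + e \<alpha>"] conjI)
  qed
  show "r *\<^sub>R f \<in> polys m D X" if f: "f \<in> polys m D X" for r f
  proof -
    obtain c where c: "\<forall>\<alpha>. c \<alpha> \<in> X" "f = fun_on D (?P c)" using f unfolding polys_def by blast
    have "r *\<^sub>R f = fun_on D (?P (\<lambda>\<alpha>. r *\<^sub>R c \<alpha>))"
      by (simp add: c fun_on_scaleR scaleR_sum_right mult.commute)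
    moreover have "\<forall>\<alpha>. r *\<^sub>R c \<alpha> \<in> X" using c(1) subspace_scale[OF X] by blast
    ultimately show ?thesis
      unfolding polys_def by (intro CollectI exI[of _ "\<lambda>\<alpha>. r *\<^sub>R c \<alpha>"] conjI)
  qed
qed

section \<open>Matrices\<close>

lemma outer_mult [simp]: "(a \<otimes>\<^sub>o b) *v w = (b \<bullet> w) *\<^sub>R a"
  by (simp add: vec_eq_iff matrix_vector_mult_def outer_def inner_vec_def sum_distrib_left sum_distrib_right algebra_simps)

lemma trace_outer [simp]: "trace (a \<otimes>\<^sub>o b) = a \<bullet> b"
  by (simp add: trace_def outer_def inner_vec_def)

lemma trace_scaleR [simp]: "trace (c *\<^sub>R A) = c * trace A" for A :: "real^'n^'n"
  by (simp add: trace_def sum_distrib_left)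

lemma trace_zero [simp]: "trace (0 :: real^'n^'n) = 0"
  by (simp add: trace_def)

lemma trace_sum: "trace (\<Sum>i\<in>I. A i) = (\<Sum>i\<in>I. trace (A i))" for A :: "'i \<Rightarrow> real^'n^'n"
  by (induction I rule: infinite_finite_induct) (auto simp: trace_add)

lemma sum_matrix_vector_mult: "(\<Sum>i\<in>I. A i) *v w = (\<Sum>i\<in>I. A i *v w)" for A :: "'i \<Rightarrow> real^'n^'m"
  by (induction I rule: infinite_finite_induct) (auto simp: matrix_vector_mult_add_rdistrib)

lemma dev_mult: "dev A *v w = A *v w - (trace A / CARD('n)) *\<^sub>R w" for A :: "real^'n^'n"
  by (simp add: dev_def matrix_vector_mult_diff_rdistrib flip: scaleR_matrix_vector_assoc)

lemma subspace_traceless: "subspace traceless_mats"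
  by (rule subspaceI) (auto simp: traceless_mats_def trace_add)

lemma linear_transpose: "linear (transpose :: real^'n^'n \<Rightarrow> _)"
  by (rule linearI) (auto simp: transpose_def vec_eq_iff)

lemma subspace_skew: "subspace skew_mats"
  by (rule subspaceI)
    (auto simp: skew_mats_def linear_0 linear_add linear_cmul linear_transpose)

lemma subspace_facet_skew: "subspace (facet_skew n)"
  unfolding facet_skew_def using subspace_skew
  by (auto simp: subspace_def matrix_vector_mult_add_rdistrib simp flip: scaleR_matrix_vector_assoc)

lemma skew_inner: "A \<in> skew_mats \<Longrightarrow> (A *v x) \<bullet> y = - (x \<bullet> (A *v y))" for A :: "real^'n^'n"
proof -
  assume "A \<in> skew_mats"
  then have "transpose A *v y = - (A *v y)"
    using matrix_vector_mult_diff_rdistrib[of 0 A y] by (simp add: skew_mats_def)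
  then have "x \<bullet> (transpose A *v y) = - (x \<bullet> (A *v y))" by simp
  moreover have "x \<bullet> (transpose A *v y) = (A *v x) \<bullet> y"
    by (simp add: inner_commute[of x] dot_lmul_matrix inner_commute[of y])
  ultimately show ?thesis by simp
qed

lemma tang_proj_eq: "tang_proj n w = w - (n \<bullet> w) *\<^sub>R n"
  by (simp add: tang_proj_def matrix_vector_mult_diff_rdistrib)

section \<open>Barycentric coordinates\<close>

text \<open>The gradients of the barycentric coordinates carry all of the geometry.  They satisfy a single linear
  relation (their sum is zero), \<open>g l\<close> is normal to the facet opposite to \<open>v l\<close>, and for fixed
  \<open>i\<close> the gradients \<open>g m\<close> and the edges \<open>v m - v i\<close>, for \<open>m \<noteq> i\<close>, are dual bases.\<close>

locale simplex_vertices =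
  fixes v :: "nat \<Rightarrow> real^'n"
  assumes nondegenerate: "nondegenerate v"
begin

abbreviation "g \<equiv> grad_barycentric v"
abbreviation "T \<equiv> simplex_of v"

lemma inj_v: "inj_on v {..CARD('n)}"
  and affine_independent: "\<not> affine_dependent (v ` {..CARD('n)})"
  using nondegenerate by (auto simp: nondegenerate_def)

lemma independent_edges:
  assumes "i \<le> CARD('n)"
  shows "independent ((\<lambda>m. v m - v i) ` ({..CARD('n)} - {i}))"
    and "card ((\<lambda>m. v m - v i) ` ({..CARD('n)} - {i})) = CARD('n)"
proof -
  have "(\<lambda>m. v m - v i) ` ({..CARD('n)} - {i}) = (\<lambda>x. - v i + x) ` (v ` {..CARD('n)} - {v i})"
    using inj_on_image_set_diff[OF inj_v, of "{..CARD('n)}" "{i}"] assms by (auto simp: image_image)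
  then show "independent ((\<lambda>m. v m - v i) ` ({..CARD('n)} - {i}))"
    using affine_independent assms affine_dependent_iff_dependent2[of "v i" "v ` {..CARD('n)}"] by simp
  have "inj_on (\<lambda>m. v m - v i) ({..CARD('n)} - {i})"
    using inj_v by (auto simp: inj_on_def)
  then show "card ((\<lambda>m. v m - v i) ` ({..CARD('n)} - {i})) = CARD('n)"
    using assms by (simp add: card_image)
qed

lemma orthogonal_edges_eq_0:
  assumes i: "i \<le> CARD('n)" and 0: "\<And>m. m \<le> CARD('n) \<Longrightarrow> w \<bullet> (v m - v i) = 0"
  shows "w = 0"
proof -
  let ?B = "(\<lambda>m. v m - v i) ` ({..CARD('n)} - {i})"
  have "UNIV \<subseteq> span ?B"
    using independent_edges[OF i] by (intro card_ge_dim_independent) auto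
  moreover have "orthogonal w x" if "x \<in> span ?B" for x
    using that by (rule orthogonal_to_span) (use 0 in \<open>auto simp: orthogonal_def\<close>)
  ultimately have "orthogonal w w" by blast
  then show ?thesis by (simp add: orthogonal_def)
qed

text \<open>The linear functional that is \<open>-1\<close> on every edge \<open>v m - v i\<close> exists because these edges are
  independent; one plus this functional, based at \<open>v i\<close>, is the coordinate.  It is unique because the
  edges at \<open>v i\<close> span the space.\<close>

lemma barycentric_exists:
  assumes i: "i \<le> CARD('n)"
  obtains a c where "barycentric v i = (\<lambda>x. a \<bullet> x + c)"
    "\<And>k. k \<le> CARD('n) \<Longrightarrow> barycentric v i (v k) = (if k = i then 1 else 0)"
proof -
  let ?B = "(\<lambda>m. v m - v i) ` ({..CARD('n)} - {i})"
  obtain L :: "real^'n \<Rightarrow> real" where L: "linear L" "\<forall>b\<in>?B. L b = - 1"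
    using linear_independent_extend[OF independent_edges(1)[OF i], of "\<lambda>_. - 1"] by blast
  define a where "a = adjoint L 1"
  have La: "L x = a \<bullet> x" for x
    using adjoint_works[OF L(1), of x 1] by (simp add: a_def inner_commute)
  let ?P = "\<lambda>f. (\<exists>a c. f = (\<lambda>x. a \<bullet> x + c)) \<and> (\<forall>k\<le>CARD('n). f (v k) = (if k = i then 1 else 0))"
  define f where "f = (\<lambda>x. a \<bullet> x + (1 - a \<bullet> v i))"
  have "f (v k) = (if k = i then 1 else 0)" if "k \<le> CARD('n)" for k
  proof (cases "k = i")
    case False
    then have "L (v k - v i) = - 1" using L(2) that by blast
    then show ?thesis using False by (simp add: La f_def inner_diff_right)
  qed (simp add: f_def)
  then have f: "?P f" unfolding f_def by blast
  have unique: "h = f" if "?P h" for h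
  proof -
    obtain b c where h: "h = (\<lambda>x. b \<bullet> x + c)" using \<open>?P h\<close> by blast
    have eq: "h (v k) = f (v k)" if "k \<le> CARD('n)" for k using \<open>?P h\<close> f that by simp
    have "b - a = 0"
    proof (rule orthogonal_edges_eq_0[OF i])
      fix m assume "m \<le> CARD('n)"
      from eq[OF this] eq[OF i] show "(b - a) \<bullet> (v m - v i) = 0"
        by (simp add: h f_def inner_diff_left inner_diff_right)
    qed
    then show "h = f" using eq[OF i] by (auto simp: h f_def)
  qed
  have "barycentric v i = f"
    unfolding barycentric_def by (rule the_equality[where P = ?P]) (fact f unique)+
  then show thesis using that[of a "1 - a \<bullet> v i"] f by (simp add: f_def)
qed

lemma barycentric_vertex:
  assumes i: "i \<le> CARD('n)" and k: "k \<le> CARD('n)"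
  shows "barycentric v i (v k) = (if k = i then 1 else 0)"
  by (rule barycentric_exists[OF i]) (use k in blast)

lemma barycentric_affine:
  assumes i: "i \<le> CARD('n)"
  obtains c where "barycentric v i = (\<lambda>x. g i \<bullet> x + c)"
proof -
  obtain a c where f: "barycentric v i = (\<lambda>x. a \<bullet> x + c)" using barycentric_exists[OF i] by blast
  have D: "GDERIV (barycentric v i) x :> a" for x
    unfolding f gderiv_def by (auto intro!: derivative_eq_intros simp: inner_commute)
  have "g i = a"
    unfolding grad_barycentric_def
  proof (rule the_equality)
    fix b assume "\<forall>x. GDERIV (barycentric v i) x :> b"
    then have "(\<lambda>h. h \<bullet> b) = (\<lambda>h. h \<bullet> a)"
      using D[of 0] unfolding gderiv_def by (blast intro: has_derivative_unique)
    then show "b = a" by (metis vector_eq_ldot)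
  qed (use D in blast)
  with f that show thesis by blast
qed

lemma barycentric_diff: "i \<le> CARD('n) \<Longrightarrow> barycentric v i x - barycentric v i y = g i \<bullet> (x - y)"
  by (erule barycentric_affine) (simp add: inner_diff_right)

lemma g_diff: "m \<le> CARD('n) \<Longrightarrow> a \<le> CARD('n) \<Longrightarrow> b \<le> CARD('n) \<Longrightarrow>
    g m \<bullet> (v b - v a) = (if b = m then 1 else 0) - (if a = m then 1 else 0)"
  by (simp add: barycentric_vertex flip: barycentric_diff)

lemma g_edge: "m \<le> CARD('n) \<Longrightarrow> a \<le> CARD('n) \<Longrightarrow> b \<le> CARD('n) \<Longrightarrow>
    g m \<bullet> edge v a b = (if b = m then 1 else 0) - (if a = m then 1 else 0)"
  by (simp add: edge_def g_diff)

lemma sum_g: "(\<Sum>m\<le>CARD('n). g m) = 0"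
  by (rule orthogonal_edges_eq_0[of 0]) (simp_all add: inner_sum_left g_diff sum_subtractf)

text \<open>Since \<open>g m \<bullet> (v k - v 0)\<close> is a difference of Kronecker deltas, both sides have the same inner
  products with the edges.  The base point \<open>z\<close> is arbitrary because the gradients sum to zero.\<close>

lemma expand_g: "w = (\<Sum>m\<le>CARD('n). (w \<bullet> (v m - z)) *\<^sub>R g m)"
proof -
  have "w - (\<Sum>m\<le>CARD('n). (w \<bullet> v m) *\<^sub>R g m) = 0"
  proof (rule orthogonal_edges_eq_0[of 0])
    fix k assume k: "k \<le> CARD('n)"
    have "(\<Sum>m\<le>CARD('n). (w \<bullet> v m) * (g m \<bullet> (v k - v 0))) = (\<Sum>m\<le>CARD('n). (if k = m then w \<bullet> v m else 0) - (if 0 = m then w \<bullet> v m else 0))"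
      using k by (intro sum.cong) (auto simp: g_diff)
    also have "\<dots> = w \<bullet> (v k - v 0)" using k by (simp add: sum_subtractf inner_diff_right)
    finally show "(w - (\<Sum>m\<le>CARD('n). (w \<bullet> v m) *\<^sub>R g m)) \<bullet> (v k - v 0) = 0"
      by (simp add: inner_diff_left inner_sum_left)
  qed simp
  moreover have "(\<Sum>m\<le>CARD('n). (w \<bullet> z) *\<^sub>R g m) = 0"
    by (simp add: sum_g flip: scaleR_sum_right)
  ultimately show ?thesis
    by (simp add: inner_diff_right scaleR_diff_left sum_subtractf)
qed

text \<open>Dual form of the expansion in gradients, obtained by pairing it with \<open>w\<close>.\<close>

lemma expand_v: "w = (\<Sum>m\<le>CARD('n). (g m \<bullet> w) *\<^sub>R (v m - z))"
proof -
  have "u \<bullet> w = u \<bullet> (\<Sum>m\<le>CARD('n). (g m \<bullet> w) *\<^sub>R (v m - z))" for u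
    by (subst expand_g[of u z]) (simp add: inner_sum_left inner_sum_right mult.commute)
  then show ?thesis by (metis vector_eq_ldot)
qed

lemma sum_barycentric: "(\<Sum>i\<le>CARD('n). barycentric v i x) = 1"
proof -
  have "(\<Sum>i\<le>CARD('n). barycentric v i x) = (\<Sum>i\<le>CARD('n). barycentric v i (v 0) + g i \<bullet> (x - v 0))"
    by (intro sum.cong) (auto simp flip: barycentric_diff)
  also have "\<dots> = (\<Sum>i\<le>CARD('n). barycentric v i (v 0)) + (\<Sum>i\<le>CARD('n). g i) \<bullet> (x - v 0)"
    by (simp add: sum.distrib inner_sum_left)
  also have "\<dots> = 1" by (simp add: sum_g barycentric_vertex)
  finally show ?thesis .
qed

lemma barycentric_combination: "x = (\<Sum>i\<le>CARD('n). barycentric v i x *\<^sub>R v i)"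
proof -
  have "x - v 0 = (\<Sum>i\<le>CARD('n). (g i \<bullet> (x - v 0)) *\<^sub>R (v i - v 0))" by (rule expand_v)
  also have "\<dots> = (\<Sum>i\<le>CARD('n). barycentric v i x *\<^sub>R (v i - v 0))"
    by (intro sum.cong) (auto simp: barycentric_vertex simp flip: barycentric_diff)
  also have "\<dots> = (\<Sum>i\<le>CARD('n). barycentric v i x *\<^sub>R v i) - v 0"
    using sum_barycentric[of x] by (simp add: scaleR_diff_right sum_subtractf flip: scaleR_sum_left)
  finally show ?thesis by simp
qed

lemma affine_interpolation:
  fixes c0 :: "'b::real_vector" and c :: "'n \<Rightarrow> 'b"
  defines "h \<equiv> \<lambda>x. c0 + (\<Sum>k\<in>UNIV. (x $ k) *\<^sub>R c k)"
  shows "h x = (\<Sum>i\<le>CARD('n). barycentric v i x *\<^sub>R h (v i))"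
proof -
  have "x $ k = (\<Sum>i\<le>CARD('n). barycentric v i x *\<^sub>R v i) $ k" for k using barycentric_combination by simp
  then have x: "x $ k = (\<Sum>i\<le>CARD('n). barycentric v i x * v i $ k)" for k by simp
  have "(\<Sum>i\<le>CARD('n). barycentric v i x *\<^sub>R h (v i))
      = (\<Sum>i\<le>CARD('n). barycentric v i x) *\<^sub>R c0 + (\<Sum>i\<le>CARD('n). \<Sum>k\<in>UNIV. (barycentric v i x * v i $ k) *\<^sub>R c k)"
    by (simp add: h_def scaleR_add_right sum.distrib scaleR_sum_left scaleR_sum_right)
  also have "(\<Sum>i\<le>CARD('n). \<Sum>k\<in>UNIV. (barycentric v i x * v i $ k) *\<^sub>R c k) = (\<Sum>k\<in>UNIV. x $ k *\<^sub>R c k)"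
    by (subst sum.swap) (simp add: x scaleR_sum_left)
  finally show ?thesis by (simp add: sum_barycentric h_def)
qed

text \<open>The sum of all gradients is, up to a factor, the only linear relation between them.\<close>

lemma g_relation:
  assumes 0: "(\<Sum>m\<le>CARD('n). c m *\<^sub>R g m) = 0" and ab: "a \<le> CARD('n)" "b \<le> CARD('n)"
  shows "c a = c b"
proof -
  have "0 = (\<Sum>m\<le>CARD('n). c m *\<^sub>R g m) \<bullet> (v b - v a)" by (simp add: 0)
  also have "\<dots> = (\<Sum>m\<le>CARD('n). (if b = m then c m else 0) - (if a = m then c m else 0))"
    unfolding inner_sum_left using ab by (intro sum.cong) (auto simp: g_diff)
  also have "\<dots> = c b - c a" using ab by (simp add: sum_subtractf)
  finally show ?thesis by simp
qed

text \<open>Leaving out one index is harmless, as the remaining gradients are still a basis.\<close>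

lemma matrix_eq_0_on_g:
  assumes "i \<le> CARD('n)" "\<And>m. m \<le> CARD('n) \<Longrightarrow> m \<noteq> i \<Longrightarrow> M *v g m = 0"
  shows "M = 0"
proof -
  have "M *v w = 0" for w
  proof -
    have "M *v w = M *v (\<Sum>m\<le>CARD('n). (w \<bullet> (v m - v i)) *\<^sub>R g m)" by (metis expand_g)
    also have "\<dots> = (\<Sum>m\<le>CARD('n). (w \<bullet> (v m - v i)) *\<^sub>R (M *v g m))"
      by (simp add: linear_sum[OF matrix_vector_mul_linear] matrix_vector_mult_scaleR)
    also have "\<dots> = 0"
    proof (rule sum.neutral, rule ballI)
      fix m assume "m \<in> {..CARD('n)}"
      then show "(w \<bullet> (v m - v i)) *\<^sub>R (M *v g m) = 0" using assms(2)[of m] by (cases "m = i") auto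
    qed
    finally show ?thesis .
  qed
  then show ?thesis by (simp add: matrix_eq)
qed

text \<open>Applying \<open>p\<close> to \<open>(\<Sum>m. g m) = 0\<close> yields a relation whose coefficients are the eigenvalues,
  so all eigenvalues agree, \<open>p\<close> is a multiple of the identity, and its trace decides.  This is what
  makes a constant traceless field determined by its tangential-normal traces.\<close>

lemma g_eigenvectors_traceless:
  assumes p: "trace p = 0" and eig: "\<And>l. l \<le> CARD('n) \<Longrightarrow> p *v g l \<in> span {g l}"
  shows "p = 0"
proof -
  have "\<exists>\<mu>. \<forall>l\<le>CARD('n). p *v g l = \<mu> l *\<^sub>R g l"
    using eig by (auto simp: span_singleton intro!: choice)
  then obtain \<mu> where \<mu>: "\<And>l. l \<le> CARD('n) \<Longrightarrow> p *v g l = \<mu> l *\<^sub>R g l" by blast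
  have "(\<Sum>l\<le>CARD('n). \<mu> l *\<^sub>R g l) = p *v (\<Sum>l\<le>CARD('n). g l)"
    by (simp add: \<mu> linear_sum[OF matrix_vector_mul_linear])
  then have eq: "\<mu> l = \<mu> 0" if "l \<le> CARD('n)" for l
    using g_relation[of \<mu> l 0] that by (simp add: sum_g)
  have "(p - \<mu> 0 *\<^sub>R mat 1) *v g l = 0" if "l \<le> CARD('n)" for l
    using \<mu>[OF that] eq[OF that] by (simp add: matrix_vector_mult_diff_rdistrib flip: scaleR_matrix_vector_assoc)
  then have "p - \<mu> 0 *\<^sub>R mat 1 = 0" by (intro matrix_eq_0_on_g[of 0]) auto
  then have p_eq: "p = \<mu> 0 *\<^sub>R mat 1" by simp
  then have "\<mu> 0 = 0" using p by (simp add: trace_I)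
  then show ?thesis using p_eq by simp
qed

text \<open>The inner sum is a matrix that is diagonal in the gradients at the vertex \<open>v i\<close>.  Applied to
  \<open>g i\<close>, the summands of the other vertices contribute multiples of \<open>g i\<close> only, while that of
  \<open>v i\<close> contributes \<open>- \<mu> i l\<close> on each other gradient.  By the uniqueness of the linear relation all
  \<open>\<mu> i l\<close> are equal, and they sum to zero.\<close>

lemma vertex_diagonal_independent:
  fixes \<mu> :: "nat \<Rightarrow> nat \<Rightarrow> real"
  assumes tr: "\<And>i. i \<le> CARD('n) \<Longrightarrow> (\<Sum>l\<in>{..CARD('n)} - {i}. \<mu> i l) = 0"
    and 0: "(\<Sum>i\<le>CARD('n). \<Sum>l\<in>{..CARD('n)} - {i}. \<mu> i l *\<^sub>R (g l \<otimes>\<^sub>o edge v i l)) = 0"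
    and il: "i \<le> CARD('n)" "l \<le> CARD('n)" "l \<noteq> i"
  shows "\<mu> i l = 0"
proof -
  define \<nu> where "\<nu> = (\<Sum>k\<in>{..CARD('n)} - {i}. \<mu> k i)"
  have row: "(\<Sum>l\<in>{..CARD('n)} - {k}. (\<mu> k l * (edge v k l \<bullet> g i)) *\<^sub>R g l)
      = (if k = i then - (\<Sum>l\<in>{..CARD('n)} - {i}. \<mu> i l *\<^sub>R g l) else \<mu> k i *\<^sub>R g i)" if k: "k \<le> CARD('n)" for k
  proof (cases "k = i")
    case True
    have "(\<Sum>l\<in>{..CARD('n)} - {k}. (\<mu> k l * (edge v k l \<bullet> g i)) *\<^sub>R g l) = (\<Sum>l\<in>{..CARD('n)} - {i}. - (\<mu> i l *\<^sub>R g l))"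
      using True il by (intro sum.cong) (auto simp: g_edge inner_commute[of "edge v _ _"])
    then show ?thesis using True by (simp add: sum_negf)
  next
    case False
    have "(\<Sum>l\<in>{..CARD('n)} - {k}. (\<mu> k l * (edge v k l \<bullet> g i)) *\<^sub>R g l) = (\<Sum>l\<in>{i}. (\<mu> k l * (edge v k l \<bullet> g i)) *\<^sub>R g l)"
      using False il k by (intro sum.mono_neutral_right) (auto simp: g_edge inner_commute[of "edge v _ _"])
    then show ?thesis using False il k by (simp add: g_edge inner_commute[of "edge v _ _"])
  qed
  have "0 = (\<Sum>k\<le>CARD('n). \<Sum>l\<in>{..CARD('n)} - {k}. \<mu> k l *\<^sub>R (g l \<otimes>\<^sub>o edge v k l)) *v g i"
    by (simp add: 0)
  also have "\<dots> = (\<Sum>k\<le>CARD('n). \<Sum>l\<in>{..CARD('n)} - {k}. (\<mu> k l * (edge v k l \<bullet> g i)) *\<^sub>R g l)"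
    by (simp add: sum_matrix_vector_mult flip: scaleR_matrix_vector_assoc)
  also have "\<dots> = (\<Sum>k\<le>CARD('n). (if k = i then - (\<Sum>l\<in>{..CARD('n)} - {i}. \<mu> i l *\<^sub>R g l) else \<mu> k i *\<^sub>R g i))"
    using row by (intro sum.cong) auto
  also have "\<dots> = - (\<Sum>l\<in>{..CARD('n)} - {i}. \<mu> i l *\<^sub>R g l) + \<nu> *\<^sub>R g i"
    using il by (simp add: sum.remove[of "{..CARD('n)}" i] \<nu>_def scaleR_sum_left)
  also have "\<dots> = - (\<Sum>l\<le>CARD('n). (if l = i then - \<nu> else \<mu> i l) *\<^sub>R g l)"
    using il by (simp add: sum.remove[of "{..CARD('n)}" i])
  finally have "(\<Sum>l\<le>CARD('n). (if l = i then - \<nu> else \<mu> i l) *\<^sub>R g l) = 0" by simp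
  from g_relation[OF this] have eq: "\<mu> i l = - \<nu>" if "l \<le> CARD('n)" "l \<noteq> i" for l
    using that il(1) by (metis (mono_tags, lifting))
  have "0 = (\<Sum>l\<in>{..CARD('n)} - {i}. - \<nu>)"
    unfolding tr[OF il(1), symmetric] by (intro sum.cong) (auto simp: eq)
  then have "\<nu> = 0" using il(1) by simp
  then show ?thesis using eq il by simp
qed

end

context simplex_vertices
begin

section \<open>Facets and normals\<close>

lemma other_vertex:
  obtains a where "a \<le> CARD('n)" "a \<noteq> l"
proof (cases "l = 0")
  case True
  then show thesis using that[of "CARD('n)"] by simp
qed (use that[of 0] in simp)

lemma g_nonzero: "l \<le> CARD('n) \<Longrightarrow> g l \<noteq> 0"
  by (rule other_vertex[of l], use g_diff[of l _ l] in fastforce)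

lemma vertex_in_facet: "k \<le> CARD('n) \<Longrightarrow> k \<noteq> l \<Longrightarrow> v k \<in> facet v l"
  unfolding facet_def by (intro hull_inc) auto

lemma facet_subset: "facet v l \<subseteq> T"
  unfolding facet_def simplex_of_def by (intro hull_mono) auto

lemma vertex_in_simplex: "k \<le> CARD('n) \<Longrightarrow> v k \<in> T"
  unfolding simplex_of_def by (intro hull_inc) auto

lemma barycentric_on_facet:
  assumes l: "l \<le> CARD('n)" and x: "x \<in> facet v l"
  shows "barycentric v l x = 0"
proof -
  obtain c where c: "barycentric v l = (\<lambda>x. g l \<bullet> x + c)" using barycentric_affine[OF l] by blast
  have "facet v l \<subseteq> {x. g l \<bullet> x = - c}"
    unfolding facet_def
  proof (rule hull_minimal)
    show "v ` ({..CARD('n)} - {l}) \<subseteq> {x. g l \<bullet> x = - c}"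
      using barycentric_vertex[OF l] c by (auto split: if_splits simp: eq_neg_iff_add_eq_0)
  qed (rule convex_hyperplane)
  then show ?thesis using x c by auto
qed

lemma barycentric_nonneg:
  assumes l: "l \<le> CARD('n)" and x: "x \<in> T"
  shows "barycentric v l x \<ge> 0"
proof -
  obtain c where c: "barycentric v l = (\<lambda>x. g l \<bullet> x + c)" using barycentric_affine[OF l] by blast
  have "T \<subseteq> {x. g l \<bullet> x \<ge> - c}"
    unfolding simplex_of_def
  proof (rule hull_minimal)
    show "v ` {..CARD('n)} \<subseteq> {x. g l \<bullet> x \<ge> - c}"
    proof clarify
      fix k assume "k \<le> CARD('n)"
      from barycentric_vertex[OF l this] show "g l \<bullet> v k \<ge> - c" by (simp add: c split: if_splits)
    qed
  qed (rule convex_halfspace_ge)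
  then show ?thesis using x c by auto
qed

lemma full_support_facet: "full_support (surface_measure (facet v l)) (facet v l)"
proof (rule full_support_surface_measure)
  show "compact (facet v l)" "convex (facet v l)"
    by (auto simp: facet_def finite_imp_compact_convex_hull convex_convex_hull)
  show "facet v l \<noteq> {}" by (rule other_vertex[of l]) (use vertex_in_facet in blast)
qed

lemma facet_nonempty: "facet v l \<noteq> {}"
  by (rule other_vertex[of l]) (use vertex_in_facet in blast)

lemma full_support_simplex: "full_support lborel T"
proof (rule full_support_lborel)
  show "compact T" "convex T"
    by (auto simp: simplex_of_def finite_imp_compact_convex_hull convex_convex_hull)
  have "card (v ` {..CARD('n)}) = Suc CARD('n)" using inj_v by (simp add: card_image)
  then show "affine hull T = UNIV"
    unfolding simplex_of_def affine_hull_convex_hull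
    using affine_independent by (intro affine_independent_span_eq) auto
qed

lemma tangent_space_iff:
  assumes l: "l \<le> CARD('n)"
  shows "t \<in> tangent_space v l \<longleftrightarrow> g l \<bullet> t = 0"
proof
  assume "t \<in> tangent_space v l"
  then show "g l \<bullet> t = 0"
    unfolding tangent_space_def
  proof (induction rule: span_induct_alt)
    case (step c x y)
    then show ?case using l by (auto simp: inner_add_right barycentric_on_facet simp flip: barycentric_diff)
  qed simp
next
  assume 0: "g l \<bullet> t = 0"
  obtain a where a: "a \<le> CARD('n)" "a \<noteq> l" by (rule other_vertex)
  have "(\<Sum>m\<le>CARD('n). (g m \<bullet> t) *\<^sub>R (v m - v a)) \<in> tangent_space v l"
    unfolding tangent_space_def
  proof (rule span_sum)
    fix m assume m: "m \<in> {..CARD('n)}"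
    show "(g m \<bullet> t) *\<^sub>R (v m - v a) \<in> span {x - y |x y. x \<in> facet v l \<and> y \<in> facet v l}"
    proof (cases "m = l")
      case False
      then show ?thesis using m a by (intro span_scale span_base) (auto intro: vertex_in_facet)
    qed (simp add: 0 span_zero)
  qed
  then show "t \<in> tangent_space v l" using expand_v[of t "v a"] by simp
qed

text \<open>In the expansion in gradients based at a vertex of the facet only the term of \<open>g l\<close> survives.\<close>

lemma orthogonal_tangents_normal:
  assumes l: "l \<le> CARD('n)" and w: "\<And>t. t \<in> tangent_space v l \<Longrightarrow> t \<bullet> w = 0"
  shows "w \<in> span {g l}"
proof -
  obtain a where a: "a \<le> CARD('n)" "a \<noteq> l" by (rule other_vertex)
  have "w = (\<Sum>m\<le>CARD('n). (w \<bullet> (v m - v a)) *\<^sub>R g m)" by (rule expand_g)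
  also have "\<dots> = (\<Sum>m\<in>{l}. (w \<bullet> (v m - v a)) *\<^sub>R g m)"
  proof (intro sum.mono_neutral_right ballI)
    fix m assume m: "m \<in> {..CARD('n)} - {l}"
    then have "v m - v a \<in> tangent_space v l" using l a by (simp add: tangent_space_iff g_diff)
    then have "(v m - v a) \<bullet> w = 0" by (rule w)
    then show "(w \<bullet> (v m - v a)) *\<^sub>R g m = 0" by (simp add: inner_commute)
  qed (use l in auto)
  also have "\<dots> \<in> span {g l}" by (simp add: span_base span_scale)
  finally show ?thesis .
qed

lemma unit_normal_multiple:
  assumes l: "l \<le> CARD('n)" and n: "unit_normal v l n"
  obtains c where "n = c *\<^sub>R g l" "\<bar>c\<bar> * norm (g l) = 1"
proof -
  have "n \<in> span {g l}"
    using n by (intro orthogonal_tangents_normal[OF l]) (auto simp: unit_normal_def inner_commute)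
  then obtain c where "n = c *\<^sub>R g l" by (auto simp: span_singleton)
  with n that show thesis by (auto simp: unit_normal_def)
qed

lemma outward_normal_eq:
  assumes l: "l \<le> CARD('n)"
  shows "outward_normal v l = (- inverse (norm (g l))) *\<^sub>R g l"
  unfolding outward_normal_def
proof (rule the_equality)
  have pos: "norm (g l) > 0" using g_nonzero[OF l] by simp
  have dot: "g l \<bullet> (x - v l) = - 1" if "x \<in> facet v l" for x
    using that l by (simp add: barycentric_on_facet barycentric_vertex flip: barycentric_diff)
  show "unit_normal v l ((- inverse (norm (g l))) *\<^sub>R g l) \<and>
      (\<forall>x\<in>facet v l. 0 < ((- inverse (norm (g l))) *\<^sub>R g l) \<bullet> (x - v l))"
    using pos l by (auto simp: unit_normal_def dot tangent_space_iff)
  fix n assume n: "unit_normal v l n \<and> (\<forall>x\<in>facet v l. 0 < n \<bullet> (x - v l))"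
  then obtain c where c: "n = c *\<^sub>R g l" "\<bar>c\<bar> * norm (g l) = 1"
    using unit_normal_multiple[OF l] by blast
  obtain x where "x \<in> facet v l" using facet_nonempty by blast
  then have "0 < - c" using n by (auto simp: c dot)
  then have "c = - inverse (norm (g l))" using c(2) pos by (simp add: field_simps)
  then show "n = (- inverse (norm (g l))) *\<^sub>R g l" by (simp add: c)
qed

lemma span_outward_normal:
  assumes "l \<le> CARD('n)"
  shows "M *v outward_normal v l \<in> span {g l} \<longleftrightarrow> M *v g l \<in> span {g l}"
proof -
  have n: "M *v outward_normal v l = (- inverse (norm (g l))) *\<^sub>R (M *v g l)"
    using assms by (simp add: outward_normal_eq matrix_vector_mult_scaleR del: scaleR_minus_left)
  then have "M *v g l = (- norm (g l)) *\<^sub>R (M *v outward_normal v l)"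
    using g_nonzero[OF assms] by simp
  with n show ?thesis by (metis span_scale)
qed

context
  fixes l :: nat and n :: "real^'n"
  assumes l: "l \<le> CARD('n)" and n: "unit_normal v l n"
begin

lemma tang_proj_normal: "w \<in> span {g l} \<Longrightarrow> tang_proj n w = 0"
proof -
  assume "w \<in> span {g l}"
  then obtain \<mu> where w: "w = \<mu> *\<^sub>R g l" by (auto simp: span_singleton)
  obtain c where c: "n = c *\<^sub>R g l" "\<bar>c\<bar> * norm (g l) = 1" by (rule unit_normal_multiple[OF l n])
  have "n \<bullet> n = 1" using n by (simp add: unit_normal_def dot_square_norm)
  then have "c * (c * (g l \<bullet> g l)) = 1" by (simp add: c)
  then show ?thesis by (simp add: tang_proj_eq w c(1) algebra_simps)
qed

lemma tang_proj_eq_0_iff: "tang_proj n w = 0 \<longleftrightarrow> w \<in> span {g l}"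
proof
  assume 0: "tang_proj n w = 0"
  obtain c where c: "n = c *\<^sub>R g l" "\<bar>c\<bar> * norm (g l) = 1" by (rule unit_normal_multiple[OF l n])
  have "w = ((n \<bullet> w) * c) *\<^sub>R g l" using 0 by (simp add: tang_proj_eq c)
  then show "w \<in> span {g l}" by (auto simp: span_singleton)
qed (rule tang_proj_normal)

lemma tang_proj_tangent:
  assumes "g l \<bullet> w = 0"
  shows "tang_proj n w = w"
proof -
  obtain c where "n = c *\<^sub>R g l" "\<bar>c\<bar> * norm (g l) = 1" by (rule unit_normal_multiple[OF l n])
  then show ?thesis using assms by (simp add: tang_proj_eq)
qed

lemma facet_skew_normal: "A \<in> facet_skew n \<Longrightarrow> A *v g l = 0"
  using l n by (elim unit_normal_multiple) (auto simp: facet_skew_def matrix_vector_mult_scaleR)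

lemma facet_skew_tangent:
  assumes "A \<in> facet_skew n"
  shows "g l \<bullet> (A *v w) = 0"
  using facet_skew_normal[OF assms] skew_inner[of A "g l" w] assms by (simp add: facet_skew_def)

text \<open>Differences of positions span the tangent space, so \<open>A\<close> vanishes there; being skew it then has
  range orthogonal to the tangent space, but it also maps into the tangent space.\<close>

lemma facet_rot_eq_0:
  assumes A: "A \<in> facet_skew n" and 0: "\<And>x. x \<in> facet v l \<Longrightarrow> A *v facet_pos (facet v l) n x = 0"
  shows "A = 0"
proof -
  have A_pos: "A *v facet_pos (facet v l) n x = A *v (x - centroid (facet v l))" for x
    using A by (simp add: facet_pos_def tang_proj_eq matrix_vector_mult_diff_distrib
        matrix_vector_mult_scaleR facet_skew_def)
  have tangent: "A *v t = 0" if "t \<in> tangent_space v l" for t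
    using that unfolding tangent_space_def
  proof (induction rule: span_induct_alt)
    case (step c x y)
    then obtain p q where pq: "p \<in> facet v l" "q \<in> facet v l" "x = p - q" by blast
    have "A *v x = A *v (p - centroid (facet v l)) - A *v (q - centroid (facet v l))"
      by (simp add: pq flip: matrix_vector_mult_diff_distrib)
    then have "A *v x = 0" using 0 pq by (simp add: A_pos)
    then show ?case using step by (simp add: matrix_vector_right_distrib matrix_vector_mult_scaleR)
  qed simp
  have "A *v y = 0" for y
  proof -
    have "t \<bullet> (A *v y) = 0" if "t \<in> tangent_space v l" for t
      using skew_inner[of A t y] tangent[OF that] A by (simp add: facet_skew_def)
    then have "A *v y \<in> span {g l}" by (rule orthogonal_tangents_normal[OF l])
    then obtain \<mu> where \<mu>: "A *v y = \<mu> *\<^sub>R g l" by (auto simp: span_singleton)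
    then have "\<mu> * (g l \<bullet> g l) = 0" using facet_skew_tangent[OF A, of y] by simp
    then show ?thesis using \<mu> g_nonzero[OF l] by simp
  qed
  then show ?thesis by (simp add: matrix_eq)
qed

end

end

context simplex_vertices
begin

section \<open>Tangential-normal traces of the enrichment\<close>

text \<open>Up to its scalar coefficient, each summand maps \<open>g m\<close> to \<open>(t\<^sub>i\<^sub>l \<bullet> g m) g i\<close> up to a multiple of \<open>g m\<close> coming from the
  deviator.  The factor \<open>t\<^sub>i\<^sub>l \<bullet> g m\<close> is zero unless \<open>m\<close> is \<open>i\<close> or \<open>l\<close>, so a facet other than
  \<open>l\<close> sees only its normal direction.  On facet \<open>l\<close> the factor is one, and the sum is the
  expansion of \<open>- w\<close> in gradients up to the normal \<open>g l\<close>.\<close>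

lemma
  fixes w :: "real^'n"
  defines "M \<equiv> \<lambda>l j. \<Sum>i\<in>{..CARD('n)} - {l, j}. (edge v i j \<bullet> w) *\<^sub>R dev (g i \<otimes>\<^sub>o edge v i l)"
  assumes l: "l \<le> CARD('n)" and j: "j \<le> CARD('n)" "j \<noteq> l"
  shows enrichment_other_facet: "m \<le> CARD('n) \<Longrightarrow> m \<noteq> l \<Longrightarrow> M l j *v g m \<in> span {g m}"
    and enrichment_own_facet: "M l j *v g l + w \<in> span {g l}"
proof -
  have mult: "M l j *v g m = (\<Sum>i\<in>{..CARD('n)} - {l, j}. (edge v i j \<bullet> w) *\<^sub>R
      ((edge v i l \<bullet> g m) *\<^sub>R g i - (g i \<bullet> edge v i l / CARD('n)) *\<^sub>R g m))" for m
    by (simp add: M_def sum_matrix_vector_mult dev_mult flip: scaleR_matrix_vector_assoc)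
  show "M l j *v g m \<in> span {g m}" if m: "m \<le> CARD('n)" "m \<noteq> l"
    unfolding mult
  proof (rule span_sum, rule span_scale, rule span_diff)
    fix i assume i: "i \<in> {..CARD('n)} - {l, j}"
    show "(edge v i l \<bullet> g m) *\<^sub>R g i \<in> span {g m}"
      using i l m by (cases "i = m") (auto simp: inner_commute[of "edge v _ _"] g_edge span_base span_neg span_zero)
  qed (simp add: span_base span_scale)
  show "M l j *v g l + w \<in> span {g l}"
  proof -
    have "M l j *v g l = (\<Sum>i\<in>{..CARD('n)} - {l, j}. (edge v i j \<bullet> w) *\<^sub>R g i)
        - (\<Sum>i\<in>{..CARD('n)} - {l, j}. (edge v i j \<bullet> w) *\<^sub>R (g i \<bullet> edge v i l / CARD('n)) *\<^sub>R g l)"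
      unfolding mult sum_subtractf[symmetric] using l
      by (intro sum.cong) (auto simp: inner_commute[of "edge v _ _" "g l"] g_edge algebra_simps)
    moreover have "(\<Sum>i\<in>{..CARD('n)} - {l, j}. (edge v i j \<bullet> w) *\<^sub>R g i) = - w - (edge v l j \<bullet> w) *\<^sub>R g l"
    proof -
      have "w = (\<Sum>m\<le>CARD('n). (w \<bullet> (v m - v j)) *\<^sub>R g m)" by (rule expand_g)
      also have "\<dots> = (\<Sum>m\<le>CARD('n). - ((edge v m j \<bullet> w) *\<^sub>R g m))"
        by (simp add: edge_def inner_commute[of w] inner_diff_left flip: scaleR_minus_left)
      also have "\<dots> = (\<Sum>m\<in>insert l ({..CARD('n)} - {l, j}). - ((edge v m j \<bullet> w) *\<^sub>R g m))"
        using l j by (intro sum.mono_neutral_right) (auto simp: edge_def)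
      finally have "w = - ((edge v l j \<bullet> w) *\<^sub>R g l) - (\<Sum>i\<in>{..CARD('n)} - {l, j}. (edge v i j \<bullet> w) *\<^sub>R g i)"
        by (simp add: sum_negf)
      moreover have "s = - w - a" if "w = - a - s" for a s :: "real^'n" using that by simp
      ultimately show ?thesis by blast
    qed
    ultimately have "M l j *v g l + w = - ((edge v l j \<bullet> w) *\<^sub>R g l)
        - (\<Sum>i\<in>{..CARD('n)} - {l, j}. (edge v i j \<bullet> w) *\<^sub>R (g i \<bullet> edge v i l / CARD('n)) *\<^sub>R g l)"
      by simp
    then show ?thesis
      by (simp add: span_neg span_diff span_sum span_scale span_base del: scaleR_scaleR)
  qed
qed

section \<open>Fields with vanishing tangential-normal trace\<close>

text \<open>The combinations with coefficients \<open>c\<close> are exactly the diagonal matrices of trace zero: the entry at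
  \<open>j\<close> balances the others.\<close>

lemma vertex_matrix_regroup:
  fixes c :: "nat \<Rightarrow> real"
  assumes "j \<le> CARD('n)" "j \<noteq> i"
  shows "(\<Sum>l\<in>{..CARD('n)} - {i, j}. c l *\<^sub>R (g l \<otimes>\<^sub>o edge v i l - g j \<otimes>\<^sub>o edge v i j))
    = (\<Sum>l\<in>{..CARD('n)} - {i}. (if l = j then - (\<Sum>l\<in>{..CARD('n)} - {i, j}. c l) else c l) *\<^sub>R (g l \<otimes>\<^sub>o edge v i l))"
proof -
  have "{..CARD('n)} - {i} = insert j ({..CARD('n)} - {i, j})" using assms by auto
  then show ?thesis
    by (simp add: scaleR_diff_right sum_subtractf scaleR_sum_left)
qed

text \<open>The value at \<open>v i\<close> of a traceless field without tangential-normal trace is of this form, since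
  \<open>v i\<close> lies on every facet except the opposite one.\<close>

lemma vertex_matrix_decomposition:
  assumes i: "i \<le> CARD('n)" and j: "j \<le> CARD('n)" "j \<noteq> i" and tr: "trace C = 0"
    and eig: "\<And>m. m \<le> CARD('n) \<Longrightarrow> m \<noteq> i \<Longrightarrow> C *v g m \<in> span {g m}"
  shows "\<exists>c. C = (\<Sum>l\<in>{..CARD('n)} - {i, j}. c l *\<^sub>R (g l \<otimes>\<^sub>o edge v i l - g j \<otimes>\<^sub>o edge v i j))"
proof -
  have "\<exists>\<mu>. \<forall>m. m \<le> CARD('n) \<and> m \<noteq> i \<longrightarrow> C *v g m = \<mu> m *\<^sub>R g m"
    using eig by (auto simp: span_singleton intro!: choice)
  then obtain \<mu> where \<mu>: "\<And>m. m \<le> CARD('n) \<Longrightarrow> m \<noteq> i \<Longrightarrow> C *v g m = \<mu> m *\<^sub>R g m" by blast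
  let ?D = "\<Sum>l\<in>{..CARD('n)} - {i}. \<mu> l *\<^sub>R (g l \<otimes>\<^sub>o edge v i l)"
  have "C - ?D = 0"
  proof (rule matrix_eq_0_on_g[OF i])
    fix m assume m: "m \<le> CARD('n)" "m \<noteq> i"
    have "?D *v g m = (\<Sum>l\<in>{..CARD('n)} - {i}. (\<mu> l * (edge v i l \<bullet> g m)) *\<^sub>R g l)"
      by (simp add: sum_matrix_vector_mult flip: scaleR_matrix_vector_assoc)
    also have "\<dots> = (\<Sum>l\<in>{m}. (\<mu> l * (edge v i l \<bullet> g m)) *\<^sub>R g l)"
      using m i by (intro sum.mono_neutral_right) (auto simp: inner_commute[of "edge v _ _"] g_edge)
    also have "\<dots> = C *v g m"
      using m i \<mu> by (simp add: inner_commute[of "edge v _ _"] g_edge)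
    finally show "(C - ?D) *v g m = 0" by (simp add: matrix_vector_mult_diff_rdistrib)
  qed
  then have C: "C = ?D" by simp
  have "trace ?D = (\<Sum>l\<in>{..CARD('n)} - {i}. \<mu> l)"
    unfolding trace_sum using i by (intro sum.cong) (auto simp: g_edge)
  moreover have "{..CARD('n)} - {i} = insert j ({..CARD('n)} - {i, j})" using j by auto
  ultimately have "\<mu> j = - (\<Sum>l\<in>{..CARD('n)} - {i, j}. \<mu> l)"
    using tr C by simp
  then have "?D = (\<Sum>l\<in>{..CARD('n)} - {i}. (if l = j then - (\<Sum>l\<in>{..CARD('n)} - {i, j}. \<mu> l) else \<mu> l) *\<^sub>R (g l \<otimes>\<^sub>o edge v i l))"
    by (intro sum.cong) auto
  with C have "C = (\<Sum>l\<in>{..CARD('n)} - {i, j}. \<mu> l *\<^sub>R (g l \<otimes>\<^sub>o edge v i l - g j \<otimes>\<^sub>o edge v i j))"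
    unfolding vertex_matrix_regroup[OF j] by (rule trans)
  then show ?thesis by (rule exI[of _ \<mu>])
qed

end

section \<open>The shape functions\<close>

locale shape_space = simplex_vertices v for v :: "nat \<Rightarrow> real^'n" +
  fixes nF :: "nat \<Rightarrow> real^'n" and j :: "nat \<Rightarrow> nat"
  assumes normals: "l \<le> CARD('n) \<Longrightarrow> unit_normal v l (nF l)"
    and j_le: "l \<le> CARD('n) \<Longrightarrow> j l \<le> CARD('n)"
    and j_neq: "l \<le> CARD('n) \<Longrightarrow> j l \<noteq> l"
begin

abbreviation "pos l \<equiv> facet_pos (facet v l) (nF l)"
abbreviation "E l \<equiv> E_fun v nF j l"

definition vertex_matrix :: "nat \<Rightarrow> nat \<Rightarrow> real^'n^'n" where
  "vertex_matrix i l = g l \<otimes>\<^sub>o edge v i l - g (j i) \<otimes>\<^sub>o edge v i (j i)"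

text \<open>The bubble vanishes on the facet opposite to \<open>v i\<close>, and on the other facets its values have
  the facet normal as an eigenvector.\<close>

definition bubble :: "nat \<Rightarrow> nat \<Rightarrow> real^'n \<Rightarrow> real^'n^'n" where
  "bubble i l = fun_on T (\<lambda>x. barycentric v i x *\<^sub>R vertex_matrix i l)"

lemma linear_E: "linear (E l)"
  by (rule linearI)
    (simp_all add: E_fun_def fun_on_add fun_on_scaleR matrix_vector_mult_add_rdistrib inner_add_right
      scaleR_add_left sum.distrib scaleR_sum_right flip: scaleR_matrix_vector_assoc)

lemma E_other_facet:
  assumes "l \<le> CARD('n)" "m \<le> CARD('n)" "m \<noteq> l"
  shows "E l A x *v g m \<in> span {g m}"
  unfolding E_fun_def fun_on_def using enrichment_other_facet assms j_le j_neq by (simp add: span_zero)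

lemma E_own_facet:
  assumes "l \<le> CARD('n)" "x \<in> T"
  shows "E l A x *v g l + A *v pos l x \<in> span {g l}"
  unfolding E_fun_def
  using enrichment_own_facet[of l "j l" "A *v pos l x"] assms j_le j_neq by simp

lemma trace_vertex_matrix: "i \<le> CARD('n) \<Longrightarrow> l \<in> {..CARD('n)} - {i, j i} \<Longrightarrow> trace (vertex_matrix i l) = 0"
  using j_le[of i] j_neq[of i, THEN not_sym] by (simp add: vertex_matrix_def trace_sub g_edge)

lemma bubble_facet:
  assumes i: "i \<le> CARD('n)" "l \<in> {..CARD('n)} - {i, j i}" and m: "m \<le> CARD('n)" "x \<in> facet v m"
  shows "bubble i l x *v g m \<in> span {g m}"
proof (cases "m = i")
  case True
  then show ?thesis
    using m facet_subset by (auto simp: bubble_def barycentric_on_facet fun_on_def span_zero)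
next
  case False
  have "vertex_matrix i l *v g m \<in> span {g m}"
    using i m False j_le[OF i(1)]
    by (auto simp: vertex_matrix_def matrix_vector_mult_diff_rdistrib inner_commute[of "edge v _ _"]
        g_edge span_base span_diff span_neg span_zero)
  then show ?thesis
    by (simp add: bubble_def fun_on_def span_zero span_scale flip: scaleR_matrix_vector_assoc)
qed

lemma subspace_B1_tn: "subspace (B1_tn v nF)"
proof -
  have tp: "tang_proj n 0 = 0" "tang_proj n (a + b) = tang_proj n a + tang_proj n b"
    "tang_proj n (c *\<^sub>R a) = c *\<^sub>R tang_proj n a" for n a b :: "real^'n" and c
    by (simp_all add: tang_proj_def matrix_vector_right_distrib matrix_vector_mult_scaleR)
  show ?thesis
    using subspace_polys[OF subspace_traceless, of 1 T]
    unfolding subspace_def B1_tn_def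
    by (auto simp: matrix_vector_mult_add_rdistrib tp simp flip: scaleR_matrix_vector_assoc)
qed

lemma bubble_in_B1_tn:
  assumes i: "i \<le> CARD('n)" "l \<in> {..CARD('n)} - {i, j i}"
  shows "bubble i l \<in> B1_tn v nF"
  unfolding B1_tn_def
proof (intro CollectI conjI allI impI ballI)
  obtain c where c: "barycentric v i = (\<lambda>x. g i \<bullet> x + c)" using barycentric_affine[OF i(1)] by blast
  have "barycentric v i x *\<^sub>R vertex_matrix i l
      = c *\<^sub>R vertex_matrix i l + (\<Sum>k\<in>UNIV. x $ k *\<^sub>R (g i $ k *\<^sub>R vertex_matrix i l))" for x
    by (simp add: c inner_vec_def scaleR_add_left add.commute mult.commute flip: scaleR_sum_left)
  then have "bubble i l = fun_on T (\<lambda>x. c *\<^sub>R vertex_matrix i l + (\<Sum>k\<in>UNIV. x $ k *\<^sub>R (g i $ k *\<^sub>R vertex_matrix i l)))"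
    unfolding bubble_def by presburger
  moreover have "r *\<^sub>R vertex_matrix i l \<in> traceless_mats" for r
    using trace_vertex_matrix[OF i] by (simp add: traceless_mats_def)
  ultimately show "bubble i l \<in> polys 1 T traceless_mats"
    unfolding polys_1
    by (intro CollectI exI[of _ "c *\<^sub>R vertex_matrix i l"] exI[of _ "\<lambda>k. g i $ k *\<^sub>R vertex_matrix i l"] conjI) auto
next
  fix m x assume "m \<le> CARD('n)" "x \<in> facet v m"
  then show "tang_proj (nF m) (bubble i l x *v outward_normal v m) = 0"
    using bubble_facet[OF i] normals by (simp add: tang_proj_eq_0_iff span_outward_normal)
qed

text \<open>An affine field is interpolated by its vertex values, and these decompose by
  \<open>vertex_matrix_decomposition\<close>.\<close>

lemma B1_tn_in_span:
  assumes b: "b \<in> B1_tn v nF"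
  shows "b \<in> span {bubble i l | i l. i \<le> CARD('n) \<and> l \<in> {..CARD('n)} - {i, j i}}"
proof -
  obtain c0 c where c: "c0 \<in> traceless_mats" "\<forall>k. c k \<in> traceless_mats"
    and b_eq: "b = fun_on T (\<lambda>x. c0 + (\<Sum>k\<in>UNIV. (x $ k) *\<^sub>R c k))"
    using b unfolding B1_tn_def polys_1 by blast
  define h where "h = (\<lambda>x. c0 + (\<Sum>k\<in>UNIV. (x $ k) *\<^sub>R c k))"
  have "\<exists>e. h (v i) = (\<Sum>l\<in>{..CARD('n)} - {i, j i}. e l *\<^sub>R vertex_matrix i l)" if i: "i \<le> CARD('n)" for i
    unfolding vertex_matrix_def
  proof (rule vertex_matrix_decomposition[OF i j_le[OF i] j_neq[OF i]])
    show "trace (h (v i)) = 0"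
      using c by (simp add: h_def traceless_mats_def trace_add trace_sum)
    fix m assume m: "m \<le> CARD('n)" "m \<noteq> i"
    have "b (v i) = h (v i)" by (simp add: b_eq h_def vertex_in_simplex i)
    moreover have "tang_proj (nF m) (b (v i) *v outward_normal v m) = 0"
      using b m i vertex_in_facet by (auto simp: B1_tn_def)
    ultimately show "h (v i) *v g m \<in> span {g m}"
      using m normals by (simp add: tang_proj_eq_0_iff span_outward_normal)
  qed
  then obtain e where e: "\<And>i. i \<le> CARD('n) \<Longrightarrow> h (v i) = (\<Sum>l\<in>{..CARD('n)} - {i, j i}. e i l *\<^sub>R vertex_matrix i l)"
    by metis
  have "h x = (\<Sum>i\<le>CARD('n). \<Sum>l\<in>{..CARD('n)} - {i, j i}. e i l *\<^sub>R barycentric v i x *\<^sub>R vertex_matrix i l)" for x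
  proof -
    have "h x = (\<Sum>i\<le>CARD('n). barycentric v i x *\<^sub>R h (v i))"
      unfolding h_def by (rule affine_interpolation)
    then show ?thesis by (simp add: e scaleR_sum_right mult.commute)
  qed
  then have h_eq: "h = (\<lambda>x. \<Sum>i\<le>CARD('n). \<Sum>l\<in>{..CARD('n)} - {i, j i}. e i l *\<^sub>R barycentric v i x *\<^sub>R vertex_matrix i l)"
    by (rule ext)
  have "b = (\<Sum>i\<le>CARD('n). \<Sum>l\<in>{..CARD('n)} - {i, j i}. e i l *\<^sub>R bubble i l)"
    unfolding b_eq h_def[symmetric] unfolding h_eq by (simp add: bubble_def fun_on_scaleR fun_on_sum)
  also have "\<dots> \<in> span {bubble i l | i l. i \<le> CARD('n) \<and> l \<in> {..CARD('n)} - {i, j i}}"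
    by (intro span_sum span_scale span_base) auto
  finally show ?thesis .
qed

section \<open>Vanishing degrees of freedom\<close>

lemma continuous_pos: "continuous_on S (\<lambda>x. B *v pos l x)"
  unfolding facet_pos_def tang_proj_def
  by (intro linear_continuous_on_compose[OF _ matrix_vector_mul_linear] continuous_intros)

lemma continuous_barycentric: "i \<le> CARD('n) \<Longrightarrow> continuous_on S (barycentric v i)"
  by (erule barycentric_affine) (simp add: continuous_intros)

text \<open>The field \<open>\<tau>\<close> below is a general element of the unconstrained space, split into its constant part
  \<open>p\<close>, its enrichment with matrices \<open>A l\<close>, and its bubbles with coefficients \<open>c\<close>.  The three families
  of moments eliminate these parts one after the other.\<close>

context
  fixes p :: "real^'n^'n" and A :: "nat \<Rightarrow> real^'n^'n" and c :: "nat \<Rightarrow> nat \<Rightarrow> real"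
    and \<tau> :: "real^'n \<Rightarrow> real^'n^'n"
  assumes p: "trace p = 0" and A: "l \<le> CARD('n) \<Longrightarrow> A l \<in> facet_skew (nF l)"
    and \<tau>: "\<tau> = fun_on T (\<lambda>_. p) + (\<Sum>l\<le>CARD('n). E l (A l)) + (\<Sum>i\<le>CARD('n). \<Sum>l\<in>{..CARD('n)} - {i, j i}. c i l *\<^sub>R bubble i l)"
begin

text \<open>Up to the normal direction, facet \<open>l\<close> sees only the constant part and its own enrichment, which is a
  rotation about the centroid.  The outward normal is \<open>- g l / norm (g l)\<close>, which cancels the sign in
  \<open>E_own_facet\<close>.\<close>

lemma normal_trace:
  assumes l: "l \<le> CARD('n)" and x: "x \<in> facet v l"
  shows "\<tau> x *v outward_normal v l - (p *v outward_normal v l + inverse (norm (g l)) *\<^sub>R (A l *v pos l x)) \<in> span {g l}"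
proof -
  have xT: "x \<in> T" using x facet_subset by blast
  have "\<tau> x *v g l - p *v g l + A l *v pos l x
      = (\<Sum>m\<in>{..CARD('n)} - {l}. E m (A m) x *v g l) + (E l (A l) x *v g l + A l *v pos l x)
        + (\<Sum>i\<le>CARD('n). \<Sum>m\<in>{..CARD('n)} - {i, j i}. c i m *\<^sub>R (bubble i m x *v g l))"
    using xT l by (simp add: \<tau> sum_fun_apply matrix_vector_mult_add_rdistrib sum_matrix_vector_mult
        sum.remove[of "{..CARD('n)}" l "\<lambda>m. E m (A m) x *v g l"] flip: scaleR_matrix_vector_assoc)
  also have "\<dots> \<in> span {g l}"
    using l x xT by (intro span_add span_sum span_scale E_other_facet E_own_facet bubble_facet) auto
  finally have "(- inverse (norm (g l))) *\<^sub>R (\<tau> x *v g l - p *v g l + A l *v pos l x) \<in> span {g l}"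
    by (rule span_scale)
  then show ?thesis
    using l by (simp add: outward_normal_eq matrix_vector_mult_scaleR algebra_simps del: scaleR_minus_left)
       (simp add: algebra_simps)
qed

text \<open>The rotational part has mean zero, so that the mean of the tangential trace is that of the constant
  part, and \<open>p\<close> has every facet normal as an eigenvector.\<close>

lemma const_moments_zero:
  assumes "\<And>l t. l \<le> CARD('n) \<Longrightarrow> t \<in> tangent_space v l \<Longrightarrow>
    L2_inner (surface_measure (facet v l)) (facet v l) (\<lambda>x. t \<bullet> (\<tau> x *v outward_normal v l)) (\<lambda>_. 1) = 0"
  shows "p = 0"
proof (rule g_eigenvectors_traceless[OF p])
  fix l assume l: "l \<le> CARD('n)"
  let ?F = "facet v l" let ?M = "surface_measure ?F"
  have "p *v outward_normal v l \<in> span {g l}"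
  proof (rule orthogonal_tangents_normal[OF l])
    fix t assume t: "t \<in> tangent_space v l"
    define a where "a = t \<bullet> (p *v outward_normal v l)"
    define w where "w = - inverse (norm (g l)) *\<^sub>R (A l *v t)"
    have "t \<bullet> (\<tau> x *v outward_normal v l) = a + (x - centroid ?F) \<bullet> w" if x: "x \<in> ?F" for x
    proof -
      obtain s where s: "\<tau> x *v outward_normal v l - (p *v outward_normal v l + inverse (norm (g l)) *\<^sub>R (A l *v pos l x)) = s *\<^sub>R g l"
        using normal_trace[OF l x] by (auto simp: span_singleton)
      then have "\<tau> x *v outward_normal v l = p *v outward_normal v l + inverse (norm (g l)) *\<^sub>R (A l *v pos l x) + s *\<^sub>R g l"
        by (simp add: diff_eq_eq)
      moreover have "t \<bullet> g l = 0" using t l by (simp add: tangent_space_iff inner_commute)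
      moreover have "t \<bullet> (A l *v pos l x) = - ((x - centroid ?F) \<bullet> (A l *v t))"
      proof -
        have "A l *v pos l x = A l *v (x - centroid ?F)"
          using A[OF l] by (simp add: facet_pos_def tang_proj_eq matrix_vector_mult_diff_distrib
              matrix_vector_mult_scaleR facet_skew_def)
        then show ?thesis
          using skew_inner[of "A l" "x - centroid ?F" t] A[OF l] by (simp add: facet_skew_def inner_commute)
      qed
      ultimately show ?thesis by (simp add: a_def w_def inner_add_right)
    qed
    then have "L2_inner ?M ?F (\<lambda>x. t \<bullet> (\<tau> x *v outward_normal v l)) (\<lambda>_. 1)
        = L2_inner ?M ?F (\<lambda>x. a + (x - centroid ?F) \<bullet> w) (\<lambda>_. 1)"
      by (intro L2_inner_cong) auto
    also have "\<dots> = L2_inner ?M ?F (\<lambda>_. a) (\<lambda>_. 1) + L2_inner ?M ?F (\<lambda>x. (x - centroid ?F) \<bullet> w) (\<lambda>_. 1)"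
      by (intro L2_inner_add_left full_support_facet continuous_intros)
    also have "L2_inner ?M ?F (\<lambda>x. (x - centroid ?F) \<bullet> w) (\<lambda>_. 1) = 0"
      using centroid_moment[OF full_support_facet facet_nonempty, of l w] by (simp add: L2_inner_def)
    also have "L2_inner ?M ?F (\<lambda>_. a) (\<lambda>_. 1) = measure ?M ?F * a"
      using full_support_facet[of l]
      by (simp add: L2_inner_def set_lebesgue_integral_def full_support_def borel_compact)
    finally have "measure ?M ?F * a = 0" using assms[OF l t] by simp
    then show "t \<bullet> (p *v outward_normal v l) = 0"
      using full_support_measure_pos[OF full_support_facet facet_nonempty, of l] by (simp add: a_def)
  qed
  then show "p *v g l \<in> span {g l}" using span_outward_normal[OF l] by simp
qed

text \<open>Testing the remaining trace, a positive multiple of \<open>x \<mapsto> A l *v pos l x\<close>, with that rotation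
  itself gives the square of a norm.\<close>

lemma rotation_moments_zero:
  assumes p0: "p = 0" and l: "l \<le> CARD('n)"
    and mom: "L2_inner (surface_measure (facet v l)) (facet v l)
      (\<lambda>x. tang_proj (nF l) (\<tau> x *v outward_normal v l)) (\<lambda>x. A l *v pos l x) = 0"
  shows "A l = 0"
proof (rule facet_rot_eq_0[OF l normals[OF l] A[OF l]])
  let ?F = "facet v l" let ?M = "surface_measure ?F"
  fix x assume x: "x \<in> ?F"
  have "tang_proj (nF l) (\<tau> y *v outward_normal v l) = inverse (norm (g l)) *\<^sub>R (A l *v pos l y)" if y: "y \<in> ?F" for y
  proof -
    let ?t = "inverse (norm (g l)) *\<^sub>R (A l *v pos l y)"
    have "\<tau> y *v outward_normal v l - ?t \<in> span {g l}" using normal_trace[OF l y] p0 by simp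
    then have "tang_proj (nF l) (\<tau> y *v outward_normal v l - ?t) = 0"
      by (rule tang_proj_normal[OF l normals[OF l]])
    moreover have "tang_proj (nF l) ?t = ?t"
      using facet_skew_tangent[OF l normals[OF l] A[OF l]] by (intro tang_proj_tangent[OF l normals[OF l]]) simp
    ultimately show ?thesis by (simp add: tang_proj_def matrix_vector_mult_diff_distrib)
  qed
  then have "L2_inner ?M ?F (\<lambda>x. tang_proj (nF l) (\<tau> x *v outward_normal v l)) (\<lambda>x. A l *v pos l x)
      = L2_inner ?M ?F (\<lambda>y. inverse (norm (g l)) *\<^sub>R (A l *v pos l y)) (\<lambda>x. A l *v pos l x)"
    by (intro L2_inner_cong) auto
  then have "L2_inner ?M ?F (\<lambda>x. A l *v pos l x) (\<lambda>x. A l *v pos l x) = 0"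
    using mom g_nonzero[OF l] by (simp add: L2_inner_scaleR_left)
  then show "A l *v pos l x = 0"
    using L2_inner_self_eq_0[OF full_support_facet continuous_pos _ x] by blast
qed

text \<open>What remains is \<open>\<Sum>i. \<lambda>\<^sub>i C\<^sub>i\<close> with traceless diagonal vertex values.  Its integral is
  \<open>\<Sum>i. w\<^sub>i C\<^sub>i\<close> with \<open>w\<^sub>i \<noteq> 0\<close>, which is itself traceless, hence an admissible test matrix and
  so zero; \<open>vertex_diagonal_independent\<close> applies to the rescaled coefficients.\<close>

lemma interior_moments_zero:
  assumes p0: "p = 0" and A0: "\<And>l. l \<le> CARD('n) \<Longrightarrow> A l = 0"
    and mom: "\<And>Q. trace Q = 0 \<Longrightarrow> L2_inner lborel T \<tau> (\<lambda>_. Q) = 0"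
    and i: "i \<le> CARD('n)" and l: "l \<in> {..CARD('n)} - {i, j i}"
  shows "c i l = 0"
proof -
  define C where "C = (\<lambda>i. \<Sum>l\<in>{..CARD('n)} - {i, j i}. c i l *\<^sub>R vertex_matrix i l)"
  define w where "w = (\<lambda>i. L2_inner lborel T (barycentric v i) (\<lambda>_. 1))"
  note cont = continuous_barycentric
  have w_nonzero: "w i \<noteq> 0" if i: "i \<le> CARD('n)" for i
  proof
    assume "w i = 0"
    then have "barycentric v i (v i) = 0"
      using i by (intro integral_eq_0_imp_zero[OF full_support_simplex cont[OF i]])
        (auto simp: w_def L2_inner_def barycentric_nonneg vertex_in_simplex)
    then show False using barycentric_vertex[OF i i] by simp
  qed
  have \<tau>_eq: "\<tau> x = (\<Sum>i\<le>CARD('n). barycentric v i x *\<^sub>R C i)" if "x \<in> T" for x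
    using that by (simp add: \<tau> p0 A0 linear_0[OF linear_E] sum_fun_apply C_def bubble_def
        scaleR_sum_right mult.commute)
  have moment: "L2_inner lborel T \<tau> (\<lambda>_. Q) = (\<Sum>i\<le>CARD('n). w i *\<^sub>R C i) \<bullet> Q" for Q
  proof -
    have "L2_inner lborel T \<tau> (\<lambda>_. Q) = L2_inner lborel T (\<lambda>x. \<Sum>i\<le>CARD('n). barycentric v i x *\<^sub>R C i) (\<lambda>_. Q)"
      using \<tau>_eq by (rule L2_inner_cong) auto
    also have "\<dots> = (\<Sum>i\<le>CARD('n). L2_inner lborel T (\<lambda>x. barycentric v i x *\<^sub>R C i) (\<lambda>_. Q))"
      using cont by (intro L2_inner_sum_left full_support_simplex continuous_intros) auto
    also have "\<dots> = (\<Sum>i\<le>CARD('n). w i * (C i \<bullet> Q))" by (simp add: L2_inner_def w_def)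
    finally show ?thesis by (simp add: inner_sum_left)
  qed
  let ?S = "\<Sum>i\<le>CARD('n). w i *\<^sub>R C i"
  have "trace ?S = 0" by (simp add: trace_sum C_def trace_vertex_matrix)
  then have "?S \<bullet> ?S = 0" using mom moment by metis
  then have S: "?S = 0" by simp
  \<comment> \<open>The entry at \<open>j i\<close> is the one that makes the diagonal matrix traceless, as in \<open>vertex_matrix_regroup\<close>.\<close>
  define \<mu> where "\<mu> = (\<lambda>i l. w i * (if l = j i then - (\<Sum>l\<in>{..CARD('n)} - {i, j i}. c i l) else c i l))"
  have "\<mu> i l = 0"
  proof (rule vertex_diagonal_independent)
    show "(\<Sum>l\<in>{..CARD('n)} - {i}. \<mu> i l) = 0" if i: "i \<le> CARD('n)" for i
    proof -
      have "{..CARD('n)} - {i} = insert (j i) ({..CARD('n)} - {i, j i})" using j_le[OF i] j_neq[OF i] by auto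
      then show ?thesis by (simp add: \<mu>_def sum_distrib_left)
    qed
    have "w i *\<^sub>R C i = (\<Sum>l\<in>{..CARD('n)} - {i}. \<mu> i l *\<^sub>R (g l \<otimes>\<^sub>o edge v i l))" if i: "i \<le> CARD('n)" for i
      unfolding C_def vertex_matrix_def vertex_matrix_regroup[OF j_le[OF i] j_neq[OF i]]
      by (simp add: scaleR_sum_right \<mu>_def)
    then show "(\<Sum>i\<le>CARD('n). \<Sum>l\<in>{..CARD('n)} - {i}. \<mu> i l *\<^sub>R (g l \<otimes>\<^sub>o edge v i l)) = 0"
      using S by simp
  qed (use i l in auto)
  then show ?thesis using w_nonzero[OF i] l by (simp add: \<mu>_def)
qed

end

end

section \<open>Degrees of freedom and shape functions as a square system\<close>

lemma independent_direct_sum: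
  assumes fin: "finite A" "finite B" and ind: "independent A" "independent B"
    and direct: "span A \<inter> span B = {0}"
  shows "A \<inter> B = {}" "independent (A \<union> B)"
proof -
  show disj: "A \<inter> B = {}"
  proof (rule ccontr)
    assume "A \<inter> B \<noteq> {}"
    then obtain x where "x \<in> A" "x \<in> B" by blast
    then have "x \<in> span A \<inter> span B" by (simp add: span_base)
    then have "0 \<in> A" using direct \<open>x \<in> A\<close> by simp
    then show False using ind(1) by (simp add: dependent_zero)
  qed
  show "independent (A \<union> B)"
  proof (rule independent_if_scalars_zero)
    fix f x assume 0: "(\<Sum>x\<in>A \<union> B. f x *\<^sub>R x) = 0" and x: "x \<in> A \<union> B"
    let ?a = "\<Sum>x\<in>A. f x *\<^sub>R x" and ?b = "\<Sum>x\<in>B. f x *\<^sub>R x"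
    have sum: "?a + ?b = 0" using 0 fin disj by (simp add: sum.union_disjoint)
    have "?a \<in> span A" "?b \<in> span B" by (intro span_sum span_scale span_base; assumption)+
    moreover have "?a = - ?b" using sum by (simp add: eq_neg_iff_add_eq_0)
    ultimately have "?a \<in> span A \<inter> span B" using span_neg[of ?b B] by simp
    then have "?a = 0" unfolding direct by simp
    then have "?a = 0" "?b = 0" using sum by simp_all
    then show "f x = 0"
      using x independentD[OF ind(1) fin(1) order_refl] independentD[OF ind(2) fin(2) order_refl] by blast
  qed (use fin in simp)
qed

text \<open>The test spaces are images of finite-dimensional matrix spaces, so their bases are finite.\<close>

lemma finite_independent_linear_image:
  fixes f :: "'a::euclidean_space \<Rightarrow> 'b::real_vector"
  assumes f: "linear f" and Q: "independent Q" "Q \<subseteq> f ` X"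
  shows "finite Q"
proof -
  obtain B where B: "B \<subseteq> X" "independent B" "X \<subseteq> span B" using basis_exists by metis
  have "Q \<subseteq> f ` span B" using Q B by blast
  also have "\<dots> = span (f ` B)" by (rule linear_span_image[OF f, symmetric])
  finally show ?thesis
    using independent_span_bound[of "f ` B" Q] Q B independent_imp_finite by blast
qed

lemma
  fixes QC :: "nat \<Rightarrow> (real^'n \<Rightarrow> real) set" and f :: "'n dof \<Rightarrow> 'c::comm_monoid_add"
  assumes fin: "\<And>l. l \<le> CARD('n) \<Longrightarrow> finite (QC l)" "\<And>l. l \<le> CARD('n) \<Longrightarrow> finite (QR l)" "finite QI"
  shows finite_dofs: "finite (dofs QC QR QI)"
    and sum_dofs: "sum f (dofs QC QR QI) =
      (\<Sum>l\<le>CARD('n). \<Sum>i\<in>{1..CARD('n) - 1}. \<Sum>q\<in>QC l. f (Facet_Const l i q))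
      + (\<Sum>l\<le>CARD('n). \<Sum>q\<in>QR l. f (Facet_Rot l q)) + (\<Sum>q\<in>QI. f (Interior q))"
proof -
  let ?C = "SIGMA l:{..CARD('n)}. {1..CARD('n) - 1} \<times> QC l" and ?R = "SIGMA l:{..CARD('n)}. QR l"
  let ?c = "\<lambda>(l, i, q). Facet_Const l i q :: 'n dof" and ?r = "\<lambda>(l, q). Facet_Rot l q :: 'n dof"
  have eq: "dofs QC QR QI = (?c ` ?C \<union> ?r ` ?R) \<union> Interior ` QI"
    by (auto simp: dofs_def image_iff)
  have fins: "finite ?C" "finite ?R" using fin by (auto intro!: finite_SigmaI)
  then show "finite (dofs QC QR QI)" unfolding eq using fin by simp
  have "sum f (dofs QC QR QI) = sum f (?c ` ?C \<union> ?r ` ?R) + sum f (Interior ` QI)"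
    unfolding eq using fin fins by (intro sum.union_disjoint) auto
  also have "sum f (?c ` ?C \<union> ?r ` ?R) = sum f (?c ` ?C) + sum f (?r ` ?R)"
    using fin fins by (intro sum.union_disjoint) auto
  also have "sum f (?c ` ?C) = sum (f \<circ> ?c) ?C" by (rule sum.reindex) (auto simp: inj_on_def)
  also have "\<dots> = (\<Sum>l\<le>CARD('n). \<Sum>(i, q)\<in>{1..CARD('n) - 1} \<times> QC l. f (Facet_Const l i q))"
    using fin by (subst sum.Sigma) (auto simp: o_def case_prod_unfold)
  also have "\<dots> = (\<Sum>l\<le>CARD('n). \<Sum>i\<in>{1..CARD('n) - 1}. \<Sum>q\<in>QC l. f (Facet_Const l i q))"
    by (simp add: sum.cartesian_product)
  also have "sum f (?r ` ?R) = sum (f \<circ> ?r) ?R" by (rule sum.reindex) (auto simp: inj_on_def)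
  also have "\<dots> = (\<Sum>l\<le>CARD('n). \<Sum>q\<in>QR l. f (Facet_Rot l q))"
    using fin by (subst sum.Sigma) (auto simp: o_def case_prod_unfold)
  also have "sum f (Interior ` QI) = (\<Sum>q\<in>QI. f (Interior q))"
    by (subst sum.reindex) (auto simp: inj_on_def)
  finally show "sum f (dofs QC QR QI) =
      (\<Sum>l\<le>CARD('n). \<Sum>i\<in>{1..CARD('n) - 1}. \<Sum>q\<in>QC l. f (Facet_Const l i q))
      + (\<Sum>l\<le>CARD('n). \<Sum>q\<in>QR l. f (Facet_Rot l q)) + (\<Sum>q\<in>QI. f (Interior q))" .
qed

lemma linear_fun_on_const: "linear (\<lambda>c. fun_on D (\<lambda>_. c))"
  by (rule linearI) (simp_all add: fun_on_add fun_on_scaleR)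

lemma continuous_on_matrix_vector:
  "continuous_on S M \<Longrightarrow> continuous_on S (\<lambda>x. M x *v w)" for M :: "(real^'k) \<Rightarrow> real^'n^'m"
  by (erule linear_continuous_on_compose[where g = "\<lambda>M. M *v w"])
    (auto intro!: linearI simp: matrix_vector_mult_add_rdistrib simp flip: scaleR_matrix_vector_assoc)

lemma continuous_on_tang_proj:
  "continuous_on S f \<Longrightarrow> continuous_on S (\<lambda>x. tang_proj n (f x))" for f :: "real^'k \<Rightarrow> real^'n"
  unfolding tang_proj_def by (erule linear_continuous_on_compose) (rule matrix_vector_mul_linear)

context shape_space
begin

definition rot :: "nat \<Rightarrow> real^'n^'n \<Rightarrow> real^'n \<Rightarrow> real^'n" where
  "rot l A = fun_on (facet v l) (\<lambda>x. A *v pos l x)"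

lemma linear_rot: "linear (rot l)"
  by (rule linearI) (simp_all add: rot_def fun_on_add fun_on_scaleR matrix_vector_mult_add_rdistrib
      flip: scaleR_matrix_vector_assoc)

lemma facet_rot_eq_image: "facet_rot (facet v l) (nF l) = rot l ` facet_skew (nF l)"
  by (auto simp: facet_rot_def rot_def)

lemma rot_eq_0: "l \<le> CARD('n) \<Longrightarrow> A \<in> facet_skew (nF l) \<Longrightarrow> rot l A = 0 \<Longrightarrow> A = 0"
  by (rule facet_rot_eq_0[OF _ normals]) (auto simp: rot_def fun_on_eq_0_iff)

lemma continuous_on_E: "continuous_on T (E l A)"
  unfolding E_fun_def continuous_on_fun_on by (intro continuous_intros continuous_pos)

lemma continuous_on_bubble: "i \<le> CARD('n) \<Longrightarrow> continuous_on T (bubble i l)"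
  unfolding bubble_def continuous_on_fun_on by (intro continuous_intros continuous_barycentric)

lemma subspace_sum_space: "subspace {p + b | p b. p \<in> P0_plus v nF j \<and> b \<in> B1_tn v nF}"
proof (intro subspace_sums subspace_B1_tn)
  show "subspace (P0_plus v nF j)"
    unfolding P0_plus_def
    by (intro subspace_sums subspace_polys[OF subspace_traceless] subspace_span)
qed

lemma const_split:
  assumes "trace Q = 0"
  obtains S K where "fun_on T (\<lambda>_. Q) = S + K"
    "S \<in> polys 0 T (sym_mats \<inter> traceless_mats)" "K \<in> polys 0 T skew_mats"
proof -
  define S where "S = (1/2) *\<^sub>R (Q + transpose Q)"
  define K where "K = (1/2) *\<^sub>R (Q - transpose Q)"
  have tr: "trace (transpose Q) = trace Q" by (simp add: trace_def transpose_def)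
  have "S \<in> sym_mats \<inter> traceless_mats"
    using assms tr by (simp add: S_def sym_mats_def traceless_mats_def trace_add linear_transpose linear_cmul linear_add add.commute)
  moreover have "K \<in> skew_mats"
    by (simp add: K_def skew_mats_def linear_transpose linear_cmul linear_diff flip: scaleR_minus_right)
  moreover have "fun_on T (\<lambda>_. Q) = fun_on T (\<lambda>_. S) + fun_on T (\<lambda>_. K)"
    by (simp add: fun_on_add S_def K_def flip: scaleR_add_right)
  ultimately show thesis using that[of "fun_on T (\<lambda>_. S)" "fun_on T (\<lambda>_. K)"] unfolding polys_0 by blast
qed

lemma sym_skew_direct:
  "polys 0 T (sym_mats \<inter> traceless_mats) \<inter> polys 0 T skew_mats = {0}"
proof -
  have "f = 0" if f: "f \<in> polys 0 T (sym_mats \<inter> traceless_mats)" "f \<in> polys 0 T skew_mats" for f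
  proof -
    obtain S where S: "f = fun_on T (\<lambda>_. S)" "S \<in> sym_mats" using f(1) by (auto simp: polys_0)
    obtain K where K: "f = fun_on T (\<lambda>_. K)" "K \<in> skew_mats" using f(2) by (auto simp: polys_0)
    have "S = K" using S(1) K(1) vertex_in_simplex[of 0] by (auto simp: fun_on_eq_iff)
    then have "S = - S" using S(2) K(2) by (simp add: sym_mats_def skew_mats_def)
    then have "S = 0" by (metis eq_neg_iff_add_eq_0 scaleR_2 scaleR_eq_0_iff zero_neq_numeral)
    then show ?thesis by (simp add: S(1) fun_on_zero)
  qed
  moreover have "0 \<in> polys 0 T (sym_mats \<inter> traceless_mats)" "0 \<in> polys 0 T skew_mats"
    unfolding polys_0 by (auto intro!: exI[of _ 0] simp: fun_on_zero sym_mats_def skew_mats_def traceless_mats_def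
        linear_0 linear_transpose)
  ultimately show ?thesis by blast
qed

end

context shape_space
begin

text \<open>The skew interior moments, with test functions in \<open>QK\<close>, are the constraints that define the shape
  space.  They complete the degrees of freedom to a coordinate system of the unconstrained space.\<close>

context
  fixes tF :: "nat \<Rightarrow> nat \<Rightarrow> real^'n" and QC :: "nat \<Rightarrow> (real^'n \<Rightarrow> real) set"
    and QR :: "nat \<Rightarrow> (real^'n \<Rightarrow> real^'n) set" and QI QK :: "(real^'n \<Rightarrow> real^'n^'n) set"
  assumes frames: "l \<le> CARD('n) \<Longrightarrow> orthonormal_frame v l (tF l)"
    and basis_const: "l \<le> CARD('n) \<Longrightarrow> basis_of (QC l) (polys 0 (facet v l) UNIV)"
    and basis_rot: "l \<le> CARD('n) \<Longrightarrow> basis_of (QR l) (facet_rot (facet v l) (nF l))"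
    and basis_interior: "basis_of QI (polys 0 T (sym_mats \<inter> traceless_mats))"
    and basis_skew: "basis_of QK (polys 0 T skew_mats)"
begin

lemma span_QC: "l \<le> CARD('n) \<Longrightarrow> span (QC l) = polys 0 (facet v l) UNIV"
  and independent_QC: "l \<le> CARD('n) \<Longrightarrow> independent (QC l)"
  using basis_const by (auto simp: basis_of_def)

lemma span_QR: "l \<le> CARD('n) \<Longrightarrow> span (QR l) = rot l ` facet_skew (nF l)"
  and independent_QR: "l \<le> CARD('n) \<Longrightarrow> independent (QR l)"
  using basis_rot by (auto simp: basis_of_def facet_rot_eq_image)

lemma QC_singleton:
  assumes l: "l \<le> CARD('n)"
  shows "\<exists>q. QC l = {q}"
proof -
  let ?e = "fun_on (facet v l) (\<lambda>_. 1 :: real)"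
  have "span (QC l) = span {?e}"
    unfolding span_QC[OF l] polys_0 span_singleton by (auto simp: fun_on_scaleR)
  moreover have "independent {?e}"
    using facet_nonempty[of l] by (auto simp: fun_on_eq_0_iff)
  ultimately have "card (QC l) = 1"
    using dim_span_eq_card_independent[OF independent_QC[OF l]]
      dim_span_eq_card_independent[of "{?e}"] by simp
  then show ?thesis by (simp add: card_1_singleton_iff)
qed

lemma finite_QC: "l \<le> CARD('n) \<Longrightarrow> finite (QC l)"
  using QC_singleton by fastforce

lemma finite_QR: "l \<le> CARD('n) \<Longrightarrow> finite (QR l)"
  using span_QR independent_QR span_superset[of "QR l"]
  by (metis finite_independent_linear_image linear_rot)

lemma finite_basis_polys_0:
  fixes X :: "(real^'n^'n) set"
  assumes "basis_of Q (polys 0 T X)"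
  shows "finite Q"
proof (rule finite_independent_linear_image)
  show "linear (\<lambda>c. fun_on T (\<lambda>_. c :: real^'n^'n))" by (rule linear_fun_on_const)
  show "Q \<subseteq> (\<lambda>c. fun_on T (\<lambda>_. c)) ` X"
    using assms span_superset[of Q] unfolding basis_of_def polys_0 by auto
qed (use assms in \<open>simp add: basis_of_def\<close>)

lemma finite_QI: "finite QI" and finite_QK: "finite QK"
  using finite_basis_polys_0 basis_interior basis_skew by blast+

lemma QI_QK: "QI \<inter> QK = {}" "independent (QI \<union> QK)"
  using independent_direct_sum[OF finite_QI finite_QK] basis_interior basis_skew sym_skew_direct
  unfolding basis_of_def by auto

lemma const_in_span_interior:
  assumes "trace Q = 0"
  shows "fun_on T (\<lambda>_. Q) \<in> span (QI \<union> QK)"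
proof -
  obtain S K where SK: "fun_on T (\<lambda>_. Q) = S + K"
    "S \<in> polys 0 T (sym_mats \<inter> traceless_mats)" "K \<in> polys 0 T skew_mats"
    by (rule const_split[OF assms])
  have "S \<in> span QI" "K \<in> span QK" using SK basis_interior basis_skew by (auto simp: basis_of_def)
  then show ?thesis
    unfolding SK(1) using span_mono[of QI "QI \<union> QK"] span_mono[of QK "QI \<union> QK"]
    by (intro span_add) auto
qed

lemma interior_const:
  assumes "q \<in> QI \<union> QK"
  shows "q = fun_on T (\<lambda>_. q (v 0))" "trace (q (v 0)) = 0"
proof -
  have "q \<in> polys 0 T (sym_mats \<inter> traceless_mats) \<or> q \<in> polys 0 T skew_mats"
    using assms basis_interior basis_skew span_superset unfolding basis_of_def by blast
  moreover have "trace A = 0" if "A \<in> skew_mats" for A :: "real^'n^'n"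
  proof -
    have "trace (transpose A) = trace A" by (simp add: trace_def transpose_def)
    then show ?thesis using that by (simp add: skew_mats_def trace_def sum_negf)
  qed
  ultimately obtain C where C: "q = fun_on T (\<lambda>_. C)" "trace C = 0"
    unfolding polys_0 traceless_mats_def by blast
  then have "q (v 0) = C" by (simp add: vertex_in_simplex)
  with C show "q = fun_on T (\<lambda>_. q (v 0))" "trace (q (v 0)) = 0" by simp_all
qed

lemma continuous_interior:
  assumes "q \<in> QI \<union> QK"
  shows "continuous_on T q"
  by (subst interior_const(1)[OF assms]) simp

text \<open>The same labels index the degrees of freedom and a spanning family \<open>s\<close> of the unconstrained space, so
  the system is square by construction: facet \<open>l\<close> has \<open>CARD('n) - 1\<close> constant moments and vertex
  \<open>v l\<close> has as many bubbles, matched by \<open>\<sigma> l\<close>; a rotational test function corresponds to the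
  enrichment with the matrix \<open>R l q\<close> that generates it; an interior test function corresponds to
  itself.\<close>

context
  fixes \<sigma> :: "nat \<Rightarrow> nat \<Rightarrow> nat" and R :: "nat \<Rightarrow> (real^'n \<Rightarrow> real^'n) \<Rightarrow> real^'n^'n"
    and s :: "'n dof \<Rightarrow> real^'n \<Rightarrow> real^'n^'n"
  assumes \<sigma>: "l \<le> CARD('n) \<Longrightarrow> bij_betw (\<sigma> l) {1..CARD('n) - 1} ({..CARD('n)} - {l, j l})"
    and R: "l \<le> CARD('n) \<Longrightarrow> q \<in> QR l \<Longrightarrow> R l q \<in> facet_skew (nF l) \<and> rot l (R l q) = q"
    and s: "s = (\<lambda>k. case k of Facet_Const l i q \<Rightarrow> bubble l (\<sigma> l i)
        | Facet_Rot l q \<Rightarrow> E l (R l q) | Interior q \<Rightarrow> q)"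
begin

abbreviation "labels \<equiv> dofs QC QR (QI \<union> QK)"

lemma continuous_s:
  assumes "k \<in> labels"
  shows "continuous_on T (s k)"
proof (cases k)
  case (Interior q)
  then have "q \<in> QI \<union> QK" using assms by (auto simp: dofs_def)
  then show ?thesis by (simp add: s Interior continuous_interior)
qed (use assms continuous_on_bubble continuous_on_E in \<open>auto simp: s dofs_def\<close>)

lemma continuous_span:
  assumes "\<tau> \<in> span (s ` labels)"
  shows "continuous_on T \<tau>"
  using assms
proof (induction rule: span_induct_alt)
  case (step c x y)
  then show ?case
    using continuous_s by (auto simp: plus_fun_def scaleR_fun_def intro!: continuous_intros)
qed (simp add: zero_fun_def)

text \<open>The matrix of a rotation depends linearly and injectively on it, so expanding the rotation in \<open>QR l\<close>
  expands the matrix, and with it the enrichment.\<close>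

lemma E_in_span:
  assumes l: "l \<le> CARD('n)" and A: "A \<in> facet_skew (nF l)"
  shows "E l A \<in> span (s ` labels)"
proof -
  have "rot l A \<in> span (QR l)" using span_QR[OF l] A by blast
  then obtain c where c: "rot l A = (\<Sum>q\<in>QR l. c q *\<^sub>R q)"
    using finite_QR[OF l] by (auto simp: span_finite)
  let ?B = "\<Sum>q\<in>QR l. c q *\<^sub>R R l q"
  have "?B \<in> facet_skew (nF l)"
    using R[OF l] by (intro subspace_sum subspace_scale subspace_facet_skew) auto
  then have "A - ?B \<in> facet_skew (nF l)" using A by (intro subspace_diff subspace_facet_skew)
  moreover have "rot l (A - ?B) = 0"
    using R[OF l] by (simp add: c linear_diff[OF linear_rot] linear_sum[OF linear_rot] linear_cmul[OF linear_rot])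
  ultimately have "A = ?B" using rot_eq_0[OF l, of "A - ?B"] by simp
  then have "E l A = (\<Sum>q\<in>QR l. c q *\<^sub>R s (Facet_Rot l q))"
    by (simp add: s linear_sum[OF linear_E] linear_cmul[OF linear_E])
  also have "\<dots> \<in> span (s ` labels)"
    using l by (intro span_sum span_scale span_base imageI) (auto simp: dofs_def)
  finally show ?thesis .
qed

lemma span_s: "span (s ` labels) = {p + b | p b. p \<in> P0_plus v nF j \<and> b \<in> B1_tn v nF}"
proof (intro equalityI)
  have zero: "0 \<in> B1_tn v nF" "0 \<in> P0_plus v nF j"
    "0 \<in> span {E l A | l A. l \<le> CARD('n) \<and> A \<in> facet_skew (nF l)}"
    "0 \<in> polys 0 T (traceless_mats :: (real^'n^'n) set)"
    using subspace_0[OF subspace_B1_tn] subspace_0[OF subspace_polys[OF subspace_traceless, of 0 T]]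
    by (auto simp: P0_plus_def span_zero intro!: exI[of _ 0])
  have left: "x \<in> {p + b | p b. p \<in> P0_plus v nF j \<and> b \<in> B1_tn v nF}" if "x \<in> P0_plus v nF j" for x
    using that zero by (intro CollectI exI[of _ x] exI[of _ 0]) simp
  have right: "x \<in> {p + b | p b. p \<in> P0_plus v nF j \<and> b \<in> B1_tn v nF}" if "x \<in> B1_tn v nF" for x
    using that zero by (intro CollectI exI[of _ 0] exI[of _ x]) simp
  show "span (s ` labels) \<subseteq> {p + b | p b. p \<in> P0_plus v nF j \<and> b \<in> B1_tn v nF}"
  proof (rule span_minimal[OF _ subspace_sum_space], rule image_subsetI)
    fix k assume k: "k \<in> labels"
    show "s k \<in> {p + b | p b. p \<in> P0_plus v nF j \<and> b \<in> B1_tn v nF}"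
    proof (cases k)
      case (Facet_Const l i q)
      then have l: "l \<le> CARD('n)" "i \<in> {1..CARD('n) - 1}" using k by (auto simp: dofs_def)
      then have "\<sigma> l i \<in> {..CARD('n)} - {l, j l}" using bij_betwE[OF \<sigma>[OF l(1)]] by blast
      then have "bubble l (\<sigma> l i) \<in> B1_tn v nF" by (rule bubble_in_B1_tn[OF l(1)])
      then show ?thesis unfolding s Facet_Const dof.case by (rule right)
    next
      case (Facet_Rot l q)
      then have "l \<le> CARD('n)" "q \<in> QR l" using k by (auto simp: dofs_def)
      then have "E l (R l q) \<in> {E l A | l A. l \<le> CARD('n) \<and> A \<in> facet_skew (nF l)}" using R by blast
      then have "E l (R l q) \<in> P0_plus v nF j"
        unfolding P0_plus_def using zero
        by (intro CollectI exI[of _ 0] exI[of _ "E l (R l q)"] conjI) (simp_all only: span_base add_0_left)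
      then show ?thesis unfolding s Facet_Rot dof.case by (rule left)
    next
      case (Interior q)
      then have "q \<in> QI \<union> QK" using k by (auto simp: dofs_def)
      from interior_const[OF this] have "q \<in> polys 0 T traceless_mats"
        unfolding polys_0 traceless_mats_def by blast
      then have "q \<in> P0_plus v nF j"
        unfolding P0_plus_def using zero
        by (intro CollectI exI[of _ q] exI[of _ 0] conjI) (simp_all only: add_0_right)
      then show ?thesis unfolding s Interior dof.case by (rule left)
    qed
  qed
  show "{p + b | p b. p \<in> P0_plus v nF j \<and> b \<in> B1_tn v nF} \<subseteq> span (s ` labels)"
  proof clarify
    fix p b assume p: "p \<in> P0_plus v nF j" and b: "b \<in> B1_tn v nF"
    obtain p0 e where p0: "p = p0 + e" "p0 \<in> polys 0 T traceless_mats"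
      and e: "e \<in> span {E l A | l A. l \<le> CARD('n) \<and> A \<in> facet_skew (nF l)}"
      using p unfolding P0_plus_def by blast
    have "e \<in> span (s ` labels)"
      using e span_minimal[of "{E l A | l A. l \<le> CARD('n) \<and> A \<in> facet_skew (nF l)}" "span (s ` labels)"]
        E_in_span by auto
    moreover have "p0 \<in> span (s ` labels)"
    proof -
      have "p0 \<in> span (QI \<union> QK)"
        using p0(2) const_in_span_interior unfolding polys_0 traceless_mats_def by blast
      moreover have "q \<in> s ` labels" if "q \<in> QI \<union> QK" for q
        using that by (intro image_eqI[where x = "Interior q"]) (auto simp: s dofs_def)
      ultimately show ?thesis using span_mono[of "QI \<union> QK" "s ` labels"] by blast
    qed
    moreover have "b \<in> span (s ` labels)"
    proof -
      have "{bubble i l | i l. i \<le> CARD('n) \<and> l \<in> {..CARD('n)} - {i, j i}} \<subseteq> s ` labels"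
      proof
        fix x assume "x \<in> {bubble i l | i l. i \<le> CARD('n) \<and> l \<in> {..CARD('n)} - {i, j i}}"
        then obtain i m where x: "x = bubble i m" and i: "i \<le> CARD('n)"
          and m: "m \<in> {..CARD('n)} - {i, j i}" by blast
        obtain a where a: "a \<in> {1..CARD('n) - 1}" "\<sigma> i a = m"
          using \<sigma>[OF i] m by (metis bij_betw_imp_surj_on imageE)
        obtain q where "QC i = {q}" using QC_singleton[OF i] by blast
        then show "x \<in> s ` labels"
          using i a by (intro image_eqI[where x = "Facet_Const i a q"]) (auto simp: x s dofs_def)
      qed
      then show ?thesis using B1_tn_in_span[OF b] span_mono by blast
    qed
    ultimately show "p + b \<in> span (s ` labels)" unfolding p0(1) by (intro span_add)
  qed
qed

lemma dof_value_linear: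
  assumes k: "k \<in> labels" and x: "continuous_on T x" and y: "continuous_on T y"
  shows "dof_value v nF tF k (x + y) = dof_value v nF tF k x + dof_value v nF tF k y"
    and "dof_value v nF tF k (c *\<^sub>R x) = c * dof_value v nF tF k x"
proof -
  have facet: "continuous_on (facet v l) (\<lambda>z. f z *v w)" if "continuous_on T f" for f :: "_ \<Rightarrow> real^'n^'n" and l w
    by (intro continuous_on_matrix_vector continuous_on_subset[OF that facet_subset])
  have tp: "tang_proj n (a + b) = tang_proj n a + tang_proj n b"
    "tang_proj n (c *\<^sub>R a) = c *\<^sub>R tang_proj n a" for n a b :: "real^'n" and c
    by (simp_all add: tang_proj_def matrix_vector_right_distrib matrix_vector_mult_scaleR)
  have scale: "L2_inner M D (\<lambda>x. c * f x) h = c * L2_inner M D f h" for M :: "(real^'n) measure" and D f h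
    using L2_inner_scaleR_left[of M D c f h] by simp
  show "dof_value v nF tF k (x + y) = dof_value v nF tF k x + dof_value v nF tF k y"
  proof (cases k)
    case (Facet_Const l i q)
    then have "l \<le> CARD('n)" "q \<in> QC l" using k by (auto simp: dofs_def)
    then have "q \<in> polys 0 (facet v l) UNIV" using span_QC span_base by blast
    then have "continuous_on (facet v l) q" by (auto simp: polys_0)
    then show ?thesis
      unfolding Facet_Const dof_value.simps plus_fun_def matrix_vector_mult_add_rdistrib inner_add_right
      using x y by (intro L2_inner_add_left full_support_facet continuous_intros facet)
  next
    case (Facet_Rot l q)
    then have "l \<le> CARD('n)" "q \<in> QR l" using k by (auto simp: dofs_def)
    then have "q \<in> rot l ` facet_skew (nF l)" using span_QR span_base by blast
    then have "continuous_on (facet v l) q" by (auto simp: rot_def continuous_pos)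
    then show ?thesis
      unfolding Facet_Rot dof_value.simps plus_fun_def matrix_vector_mult_add_rdistrib tp
      using x y by (intro L2_inner_add_left full_support_facet continuous_on_tang_proj facet)
  next
    case (Interior q)
    then have "continuous_on T q" using k by (intro continuous_interior) (auto simp: dofs_def)
    then show ?thesis
      unfolding Interior dof_value.simps plus_fun_def
      using x y by (intro L2_inner_add_left full_support_simplex)
  qed
  show "dof_value v nF tF k (c *\<^sub>R x) = c * dof_value v nF tF k x"
    by (cases k) (simp_all add: scaleR_fun_def tp L2_inner_scaleR_left scale flip: scaleR_matrix_vector_assoc)
qed

text \<open>A combination of the family is split by the kind of label into constant part, enrichment and bubbles.
  Once these parts vanish, independence of the test bases yields zero coefficients.\<close>

lemma trivial_kernel:
  assumes 0: "\<forall>k\<in>labels. dof_value v nF tF k (\<Sum>k\<in>labels. c k *\<^sub>R s k) = 0"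
  shows "\<forall>k\<in>labels. c k = 0"
proof -
  define \<tau> where "\<tau> = (\<Sum>k\<in>labels. c k *\<^sub>R s k)"
  have dof0: "dof_value v nF tF k \<tau> = 0" if "k \<in> labels" for k
    using 0 that unfolding \<tau>_def by blast
  define p where "p = (\<Sum>q\<in>QI \<union> QK. c (Interior q) *\<^sub>R q (v 0))"
  define A where "A = (\<lambda>l. \<Sum>q\<in>QR l. c (Facet_Rot l q) *\<^sub>R R l q)"
  \<comment> \<open>\<open>QC l\<close> is a basis of a one-dimensional space, so it has a single element.\<close>
  define qc where "qc = (\<lambda>l. the_elem (QC l))"
  have qc: "QC l = {qc l}" if "l \<le> CARD('n)" for l
  proof -
    obtain q where "QC l = {q}" using QC_singleton[OF \<open>l \<le> CARD('n)\<close>] by blast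
    then show ?thesis unfolding qc_def by simp
  qed
  define e where "e = (\<lambda>l m. c (Facet_Const l (inv_into {1..CARD('n) - 1} (\<sigma> l) m) (qc l)))"
  have e: "e l (\<sigma> l i) = c (Facet_Const l i (qc l))" if "l \<le> CARD('n)" "i \<in> {1..CARD('n) - 1}" for l i
    using bij_betw_inv_into_left[OF \<sigma>[OF that(1)] that(2)] by (simp add: e_def)
  have p_fun: "fun_on T (\<lambda>_. p) = (\<Sum>q\<in>QI \<union> QK. c (Interior q) *\<^sub>R q)"
  proof -
    have "fun_on T (\<lambda>_. p) = (\<Sum>q\<in>QI \<union> QK. c (Interior q) *\<^sub>R fun_on T (\<lambda>_. q (v 0)))"
      unfolding p_def by (simp add: linear_sum[OF linear_fun_on_const] linear_cmul[OF linear_fun_on_const])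
    also have "\<dots> = (\<Sum>q\<in>QI \<union> QK. c (Interior q) *\<^sub>R q)"
      using interior_const(1) by (intro sum.cong) auto
    finally show ?thesis .
  qed
  have \<tau>_eq: "\<tau> = fun_on T (\<lambda>_. p) + (\<Sum>l\<le>CARD('n). E l (A l))
      + (\<Sum>i\<le>CARD('n). \<Sum>l\<in>{..CARD('n)} - {i, j i}. e i l *\<^sub>R bubble i l)"
  proof -
    have "\<tau> = (\<Sum>l\<le>CARD('n). \<Sum>i\<in>{1..CARD('n) - 1}. \<Sum>q\<in>QC l. c (Facet_Const l i q) *\<^sub>R bubble l (\<sigma> l i))
        + (\<Sum>l\<le>CARD('n). \<Sum>q\<in>QR l. c (Facet_Rot l q) *\<^sub>R E l (R l q))
        + (\<Sum>q\<in>QI \<union> QK. c (Interior q) *\<^sub>R q)"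
      unfolding \<tau>_def using finite_QC finite_QR finite_QI finite_QK
      by (subst sum_dofs) (auto simp: s)
    also have "(\<Sum>l\<le>CARD('n). \<Sum>i\<in>{1..CARD('n) - 1}. \<Sum>q\<in>QC l. c (Facet_Const l i q) *\<^sub>R bubble l (\<sigma> l i))
        = (\<Sum>l\<le>CARD('n). \<Sum>m\<in>{..CARD('n)} - {l, j l}. e l m *\<^sub>R bubble l m)"
    proof (rule sum.cong[OF refl])
      fix l assume "l \<in> {..CARD('n)}"
      then have l: "l \<le> CARD('n)" by simp
      have "(\<Sum>i\<in>{1..CARD('n) - 1}. \<Sum>q\<in>QC l. c (Facet_Const l i q) *\<^sub>R bubble l (\<sigma> l i))
          = (\<Sum>i\<in>{1..CARD('n) - 1}. e l (\<sigma> l i) *\<^sub>R bubble l (\<sigma> l i))"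
        using e[OF l] by (intro sum.cong) (auto simp: qc[OF l])
      also have "\<dots> = (\<Sum>m\<in>{..CARD('n)} - {l, j l}. e l m *\<^sub>R bubble l m)"
        by (rule sum.reindex_bij_betw[OF \<sigma>[OF l]])
      finally show "(\<Sum>i\<in>{1..CARD('n) - 1}. \<Sum>q\<in>QC l. c (Facet_Const l i q) *\<^sub>R bubble l (\<sigma> l i))
        = (\<Sum>m\<in>{..CARD('n)} - {l, j l}. e l m *\<^sub>R bubble l m)" .
    qed
    also have "(\<Sum>l\<le>CARD('n). \<Sum>q\<in>QR l. c (Facet_Rot l q) *\<^sub>R E l (R l q)) = (\<Sum>l\<le>CARD('n). E l (A l))"
      by (simp add: A_def linear_sum[OF linear_E] linear_cmul[OF linear_E])
    finally show ?thesis unfolding p_fun by (simp only: add_ac)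
  qed
  have p: "trace p = 0" using interior_const(2) by (simp add: p_def trace_sum)
  have A: "A l \<in> facet_skew (nF l)" if "l \<le> CARD('n)" for l
    unfolding A_def using R[OF that] by (intro subspace_sum subspace_scale subspace_facet_skew) auto
  have \<tau>_cont: "continuous_on T \<tau>"
    unfolding \<tau>_def by (intro continuous_span span_sum span_scale span_base imageI)
  have cont: "continuous_on (facet v l) (\<lambda>x. \<tau> x *v w)" for l w
    by (intro continuous_on_matrix_vector continuous_on_subset[OF \<tau>_cont facet_subset])
  have p0: "p = 0"
  proof (rule const_moments_zero[OF p A \<tau>_eq])
    fix l t assume l: "l \<le> CARD('n)" and t: "t \<in> tangent_space v l"
    let ?L = "\<lambda>t. L2_inner (surface_measure (facet v l)) (facet v l) (\<lambda>x. t \<bullet> (\<tau> x *v outward_normal v l)) (\<lambda>_. 1)"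
    have frame: "?L (tF l i) = 0" if i: "i \<in> {1..CARD('n) - 1}" for i
    proof -
      let ?f = "\<lambda>x. tF l i \<bullet> (\<tau> x *v outward_normal v l)"
      have "L2_inner (surface_measure (facet v l)) (facet v l) ?f (fun_on (facet v l) (\<lambda>_. 1)) = 0"
      proof (rule L2_inner_zero_on_span[OF full_support_facet, where Q = "QC l"])
        fix q assume q: "q \<in> QC l"
        then have "q \<in> polys 0 (facet v l) UNIV" using span_QC[OF l] span_base by blast
        then have "continuous_on (facet v l) q" by (auto simp: polys_0)
        moreover have "Facet_Const l i q \<in> labels" using l i q by (auto simp: dofs_def)
        ultimately show "continuous_on (facet v l) q \<and> L2_inner (surface_measure (facet v l)) (facet v l) ?f q = 0"
          using dof0[of "Facet_Const l i q"] by simp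
      qed (use span_QC[OF l] in \<open>auto simp: polys_0 intro!: continuous_intros cont\<close>)
      then show ?thesis by (subst L2_inner_cong[where g' = "fun_on (facet v l) (\<lambda>_. 1)"]) auto
    qed
    have "t \<in> span (tF l ` {1..CARD('n) - 1})" using t frames[OF l] by (simp add: orthonormal_frame_def)
    then show "?L t = 0"
    proof (induction rule: span_induct_alt)
      case base
      show ?case by (simp add: L2_inner_def set_lebesgue_integral_def)
    next
      case (step a x y)
      have "?L (a *\<^sub>R x + y) = a * ?L x + ?L y"
        unfolding inner_add_left inner_scaleR_left
        using L2_inner_scaleR_left[of _ _ a "\<lambda>z. x \<bullet> (\<tau> z *v outward_normal v l)" "\<lambda>_. 1"]
        by (subst L2_inner_add_left) (auto intro!: full_support_facet continuous_intros cont)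
      then show ?case using step frame by auto
    qed
  qed
  have A0: "A l = 0" if l: "l \<le> CARD('n)" for l
  proof (rule rotation_moments_zero[OF p A \<tau>_eq p0 l])
    let ?f = "\<lambda>x. tang_proj (nF l) (\<tau> x *v outward_normal v l)"
    have "L2_inner (surface_measure (facet v l)) (facet v l) ?f (rot l (A l)) = 0"
    proof (rule L2_inner_zero_on_span[OF full_support_facet, where Q = "QR l"])
      fix q assume q: "q \<in> QR l"
      then have "q \<in> rot l ` facet_skew (nF l)" using span_QR[OF l] span_base by blast
      then have "continuous_on (facet v l) q" by (auto simp: rot_def continuous_pos)
      moreover have "Facet_Rot l q \<in> labels" using l q by (auto simp: dofs_def)
      ultimately show "continuous_on (facet v l) q \<and> L2_inner (surface_measure (facet v l)) (facet v l) ?f q = 0"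
        using dof0[of "Facet_Rot l q"] by simp
    qed (use span_QR[OF l] A[OF l] in \<open>auto intro!: continuous_on_tang_proj cont\<close>)
    then show "L2_inner (surface_measure (facet v l)) (facet v l) ?f (\<lambda>x. A l *v pos l x) = 0"
      by (subst L2_inner_cong[where g' = "rot l (A l)"]) (auto simp: rot_def)
  qed
  have e0: "e i l = 0" if i: "i \<le> CARD('n)" "l \<in> {..CARD('n)} - {i, j i}" for i l
  proof (rule interior_moments_zero[OF p A \<tau>_eq p0 A0 _ i])
    fix Q :: "real^'n^'n" assume Q: "trace Q = 0"
    have "L2_inner lborel T \<tau> (fun_on T (\<lambda>_. Q)) = 0"
    proof (rule L2_inner_zero_on_span[OF full_support_simplex \<tau>_cont _ const_in_span_interior[OF Q]])
      fix q assume q: "q \<in> QI \<union> QK"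
      then have "continuous_on T q" by (rule continuous_interior)
      moreover have "Interior q \<in> labels" using q by (auto simp: dofs_def)
      ultimately show "continuous_on T q \<and> L2_inner lborel T \<tau> q = 0"
        using dof0[of "Interior q"] by simp
    qed
    then show "L2_inner lborel T \<tau> (\<lambda>_. Q) = 0"
      by (subst L2_inner_cong[where g' = "fun_on T (\<lambda>_. Q)"]) auto
  qed auto
  show ?thesis
  proof
    fix k assume k: "k \<in> labels"
    show "c k = 0"
    proof (cases k)
      case (Facet_Const l i q)
      then have l: "l \<le> CARD('n)" "i \<in> {1..CARD('n) - 1}" "q = qc l" using k qc by (auto simp: dofs_def)
      have "\<sigma> l i \<in> {..CARD('n)} - {l, j l}" using bij_betwE[OF \<sigma>[OF l(1)]] l(2) by blast
      then show ?thesis using e0[OF l(1)] e[OF l(1,2)] l(3) Facet_Const by simp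
    next
      case (Facet_Rot l q)
      then have l: "l \<le> CARD('n)" "q \<in> QR l" using k by (auto simp: dofs_def)
      have "(\<Sum>q\<in>QR l. c (Facet_Rot l q) *\<^sub>R q) = rot l (A l)"
        unfolding A_def using R[OF l(1)] by (simp add: linear_sum[OF linear_rot] linear_cmul[OF linear_rot])
      also have "\<dots> = 0" by (simp add: A0[OF l(1)] linear_0[OF linear_rot])
      finally show ?thesis
        using independentD[OF independent_QR[OF l(1)] finite_QR[OF l(1)] order_refl _ l(2), of "\<lambda>q. c (Facet_Rot l q)"]
          Facet_Rot by simp
    next
      case (Interior q)
      then have q: "q \<in> QI \<union> QK" using k by (auto simp: dofs_def)
      have "(\<Sum>q\<in>QI \<union> QK. c (Interior q) *\<^sub>R q) = 0" by (simp add: p0 fun_on_zero flip: p_fun)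
      then show ?thesis
        using independentD[OF QI_QK(2) _ order_refl _ q, of "\<lambda>q. c (Interior q)"]
          finite_QI finite_QK Interior by simp
    qed
  qed
qed

lemma Sigma0_plus_eq:
  "Sigma0_plus v nF j = {\<tau> \<in> span (s ` labels). \<forall>k\<in>labels - dofs QC QR QI. dof_value v nF tF k \<tau> = 0}"
proof -
  have new: "labels - dofs QC QR QI = Interior ` QK"
    using QI_QK(1) by (auto simp: dofs_def)
  have "(\<forall>q\<in>polys 0 T skew_mats. L2_inner lborel T \<tau> q = 0) \<longleftrightarrow> (\<forall>q\<in>QK. L2_inner lborel T \<tau> q = 0)"
    if "\<tau> \<in> span (s ` labels)" for \<tau>
  proof
    assume "\<forall>q\<in>polys 0 T skew_mats. L2_inner lborel T \<tau> q = 0"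
    then show "\<forall>q\<in>QK. L2_inner lborel T \<tau> q = 0"
      using basis_skew span_base unfolding basis_of_def by blast
  next
    assume QK: "\<forall>q\<in>QK. L2_inner lborel T \<tau> q = 0"
    have "continuous_on T q" if "q \<in> QK" for q
      using that by (intro continuous_interior) simp
    with QK show "\<forall>q\<in>polys 0 T skew_mats. L2_inner lborel T \<tau> q = 0"
      using L2_inner_zero_on_span[OF full_support_simplex continuous_span[OF that], of QK] basis_skew
      unfolding basis_of_def by blast
  qed
  then show ?thesis
    unfolding Sigma0_plus_def new using span_s by auto
qed

lemma unisolvent_of_shapes: "unisolvent (Sigma0_plus v nF j) (dofs QC QR QI) (dof_value v nF tF)"
  unfolding Sigma0_plus_eq
proof (rule unisolvent_kernel)
  show "finite labels" using finite_QC finite_QR finite_QI finite_QK by (intro finite_dofs) auto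
  then show "finite labels" .
  show "dofs QC QR QI \<subseteq> labels" by (auto simp: dofs_def)
next
  fix k \<tau> and c :: real
  assume "k \<in> labels" "\<tau> \<in> span (s ` labels)"
  then show "dof_value v nF tF k (c *\<^sub>R \<tau>) = c * dof_value v nF tF k \<tau>"
    using continuous_span by (intro dof_value_linear(2)) auto
next
  fix c :: "'n dof \<Rightarrow> real"
  assume "\<forall>k\<in>labels. dof_value v nF tF k (\<Sum>i\<in>labels. c i *\<^sub>R s i) = 0"
  then show "\<forall>i\<in>labels. c i = 0" by (rule trivial_kernel)
qed (use dof_value_linear(1) continuous_span in auto)

end

theorem unisolvent_shape_space: "unisolvent (Sigma0_plus v nF j) (dofs QC QR QI) (dof_value v nF tF)"
proof -
  have "\<exists>f. bij_betw f {1..CARD('n) - 1} ({..CARD('n)} - {l, j l})" if l: "l \<le> CARD('n)" for l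
    using l j_le[OF l] j_neq[OF l] by (intro finite_same_card_bij) (auto simp: card_Diff_subset)
  then obtain \<sigma> where \<sigma>: "\<And>l. l \<le> CARD('n) \<Longrightarrow> bij_betw (\<sigma> l) {1..CARD('n) - 1} ({..CARD('n)} - {l, j l})"
    by metis
  define R where "R = (\<lambda>l. inv_into (facet_skew (nF l)) (rot l))"
  have R: "R l q \<in> facet_skew (nF l) \<and> rot l (R l q) = q" if l: "l \<le> CARD('n)" and q: "q \<in> QR l" for l q
  proof -
    have "q \<in> rot l ` facet_skew (nF l)" using span_base[OF q] span_QR[OF l] by simp
    then show ?thesis unfolding R_def by (blast intro: inv_into_into f_inv_into_f)
  qed
  show ?thesis by (rule unisolvent_of_shapes[OF \<sigma> R refl])
qed

end

end

theorem lemma2p3: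
  fixes v :: "nat \<Rightarrow> real^'n"
    and nF :: "nat \<Rightarrow> real^'n"
    and tF :: "nat \<Rightarrow> nat \<Rightarrow> real^'n"
    and j :: "nat \<Rightarrow> nat"
    and QC :: "nat \<Rightarrow> (real^'n \<Rightarrow> real) set"
    and QR :: "nat \<Rightarrow> (real^'n \<Rightarrow> real^'n) set"
    and QI :: "(real^'n \<Rightarrow> real^'n^'n) set"
  assumes dim_ge_2: "CARD('n) \<ge> 2"
    and simplex: "nondegenerate v"
    and normals: "\<And>l. l \<le> CARD('n) \<Longrightarrow> unit_normal v l (nF l)"
    and frames: "\<And>l. l \<le> CARD('n) \<Longrightarrow> orthonormal_frame v l (tF l)"
    and indices: "\<And>l. l \<le> CARD('n) \<Longrightarrow> j l \<in> {..CARD('n)} - {l}"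
    and basis_const: "\<And>l. l \<le> CARD('n) \<Longrightarrow> basis_of (QC l) (polys 0 (facet v l) UNIV)"
    and basis_rot: "\<And>l. l \<le> CARD('n) \<Longrightarrow> basis_of (QR l) (facet_rot (facet v l) (nF l))"
    and basis_interior:
      "basis_of QI (polys 0 (simplex_of v) (sym_mats \<inter> traceless_mats))"
  shows "unisolvent (Sigma0_plus v nF j) (dofs QC QR QI) (dof_value v nF tF)"
proof -
  interpret shape_space v nF j
    using simplex normals indices by unfold_locales auto
  obtain QK :: "(real^'n \<Rightarrow> real^'n^'n) set" where skew: "basis_of QK (polys 0 (simplex_of v) skew_mats)"
    using basis_exists[of "polys 0 (simplex_of v) skew_mats"] span_minimal[OF _ subspace_polys[OF subspace_skew]]
    unfolding basis_of_def by (metis subset_antisym)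
  show ?thesis
    by (rule unisolvent_shape_space) (fact frames basis_const basis_rot basis_interior skew)+
qed

end
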